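(* Let $X\in 2^\omega$ be a real with $X \geq_{tt} 0'$. Then there exists a real $Y$ such that $Y \oplus 0' \equiv_{tt} Y' \equiv_{tt} X$.
   Context: Reals are elements of $2^\omega$. A Turing functional $\Phi$ is a truth-table reduction if there is a computable $f:\omega\to\omega$ such that for every $n$ and every binary string $\sigma$ of length $f(n)$, $\Phi^\sigma(n)$ converges; $A\leq_{tt}B$ means $\Phi(B)=A$ for some truth-table reduction $\Phi$, and $A\equiv_{tt}B$ means $A\leq_{tt}B$ and $B\leq_{tt}A$. $Y'$ denotes the Turing jump of $Y$, $0'$ the halting set, and $A\oplus B=\{2n:n\in A\}\cup\{2n+1:n\in B\}$. *)

theory Defs
  imports Main "HOL-Library.Nat_Bijection"
begin

text \<open>Programs for partial recursive functions relative to an oracle.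
  Functions take a list of natural-number arguments; missing arguments read as 0.
  Orc queries the oracle at its first argument and returns 1 (true) or 0 (false);
  if the oracle is undefined there (finite string oracle queried beyond its length),
  the computation diverges.\<close>

datatype rf = Z | S | Proj nat | Comp rf "rf list" | Prec rf rf | Mn rf | Orc

definition arg :: "nat \<Rightarrow> nat list \<Rightarrow> nat" where
  "arg i xs = (if i < length xs then xs ! i else 0)"

inductive eval :: "(nat \<Rightarrow> bool option) \<Rightarrow> rf \<Rightarrow> nat list \<Rightarrow> nat \<Rightarrow> bool"
  for Or :: "nat \<Rightarrow> bool option" where
  eval_Z: "eval Or Z xs 0"
| eval_S: "eval Or S xs (Suc (arg 0 xs))"
| eval_Proj: "eval Or (Proj i) xs (arg i xs)"
| eval_Orc: "Or (arg 0 xs) = Some b \<Longrightarrow> eval Or Orc xs (if b then 1 else 0)"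
| eval_Comp: "length ys = length gs \<Longrightarrow> (\<forall>i<length gs. eval Or (gs ! i) xs (ys ! i))
     \<Longrightarrow> eval Or f ys z \<Longrightarrow> eval Or (Comp f gs) xs z"
| eval_Prec0: "eval Or f ys z \<Longrightarrow> eval Or (Prec f g) (0 # ys) z"
| eval_PrecS: "eval Or (Prec f g) (x # ys) y \<Longrightarrow> eval Or g (x # y # ys) z
     \<Longrightarrow> eval Or (Prec f g) (Suc x # ys) z"
| eval_Mn: "eval Or f (y # xs) 0 \<Longrightarrow> (\<forall>z<y. \<exists>v. 0 < v \<and> eval Or f (z # xs) v)
     \<Longrightarrow> eval Or (Mn f) xs y"

primrec encode :: "rf \<Rightarrow> nat" where
  "encode Z = 0"
| "encode S = 1"
| "encode Orc = 2"
| "encode (Proj i) = 3 + 7 * i"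
| "encode (Comp f gs) = 4 + 7 * prod_encode (encode f, list_encode (map encode gs))"
| "encode (Prec f g) = 5 + 7 * prod_encode (encode f, encode g)"
| "encode (Mn f) = 6 + 7 * encode f"

definition set_oracle :: "nat set \<Rightarrow> nat \<Rightarrow> bool option" where
  "set_oracle A n = Some (n \<in> A)"

definition str_oracle :: "bool list \<Rightarrow> nat \<Rightarrow> bool option" where
  "str_oracle \<sigma> n = (if n < length \<sigma> then Some (\<sigma> ! n) else None)"

definition chi :: "nat set \<Rightarrow> nat \<Rightarrow> nat" where
  "chi A n = (if n \<in> A then 1 else 0)"

definition jump :: "nat set \<Rightarrow> nat set" where
  "jump Y = {n. \<exists>p. encode p = n \<and> (\<exists>v. eval (set_oracle Y) p [n] v)}"

definition halting :: "nat set" where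
  "halting = jump {}"

definition join :: "nat set \<Rightarrow> nat set \<Rightarrow> nat set" where
  "join A B = {2 * n | n. n \<in> A} \<union> {2 * n + 1 | n. n \<in> B}"

definition computable :: "(nat \<Rightarrow> nat) \<Rightarrow> bool" where
  "computable f \<longleftrightarrow> (\<exists>q. \<forall>n. eval (\<lambda>_. None) q [n] (f n))"

definition tt_functional :: "rf \<Rightarrow> bool" where
  "tt_functional p \<longleftrightarrow> (\<exists>f. computable f \<and>
     (\<forall>n \<sigma>. length \<sigma> = f n \<longrightarrow> (\<exists>v. eval (str_oracle \<sigma>) p [n] v)))"

definition tt_le :: "nat set \<Rightarrow> nat set \<Rightarrow> bool" where
  "tt_le A B \<longleftrightarrow> (\<exists>p. tt_functional p \<and> (\<forall>n. eval (set_oracle B) p [n] (chi A n)))"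

definition tt_eq :: "nat set \<Rightarrow> nat set \<Rightarrow> bool" where
  "tt_eq A B \<longleftrightarrow> tt_le A B \<and> tt_le B A"

end

theory Submission
  imports Defs
begin

text \<open>
  Finite-extension forcing does not give truth-table reductions, because the search for a forcing
  extension diverges on a wrong oracle. Instead one forces with effectively closed classes, as in the
  superlow basis theorem: to decide \<open>e \<in> Y'\<close>, ask \<open>0'\<close> whether the subclass of the current
  class on which the \<open>e\<close>-th computation diverges is empty, and pass to it if not. The index of the
  next class depends only on the answers, so there is no search and the use is bounded.
  To code \<open>X\<close> as well, start inside a class of diagonally nonrecursive type: the index of a nonempty
  subclass then yields effectively a number \<open>n\<close> such that the subclass has members containing \<open>n\<close>
  and members omitting \<open>n\<close>, and \<open>X(e)\<close> is coded as \<open>Y(n)\<close>. The run of the construction can be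
  retraced from \<open>X \<oplus> 0'\<close> and equally from \<open>Y \<oplus> 0'\<close>, and it computes both \<open>Y'\<close> and \<open>X\<close>.
\<close>

section \<open>Recursive functions between numbered types\<close>

text \<open>All requirements on \<open>Y\<close> have one form, namely that some number stays out of
  \<open>jump Y\<close>: starting in the parity class forbids a fixed \<open>d\<close>, keeping
  \<open>e\<close> out of the jump forbids \<open>e\<close>, and prescribing the bit of
  \<open>Y\<close> at \<open>n\<close> to be \<open>b\<close> forbids a suitable number
  \<open>j (n, b)\<close>. A class is therefore a finite list, and a step adds at most one number to
  it. That a class is empty is an existential statement by compactness of Cantor space, hence one
  query to the halting set. Self-reference needs no recursion theorem: the jump and the parity class
  run a program on its own code, so the program receives its code as argument and only the list has
  to be built in as a parameter. The bits learnt along the run are exactly the bits of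
  \<open>join (jump Y) X\<close>. This set is at once the output of the run and the record that
  drives it.\<close>

lemma arg_simps [simp]:
  "arg 0 (x # xs) = x" "arg (Suc i) (x # xs) = arg i xs" "arg i [] = 0"
  "arg (numeral k) (x # xs) = arg (pred_numeral k) xs" "arg 1 (x # xs) = arg 0 xs"
  by (auto simp: arg_def numeral_eq_Suc)

lemma eval_Proj': "v = arg i xs \<Longrightarrow> eval Or (Proj i) xs v"
  by (simp add: eval_Proj)

lemma eval_S': "v = Suc (arg 0 xs) \<Longrightarrow> eval Or S xs v"
  by (simp add: eval_S)

lemma eval_Comp1: "eval Or g xs y \<Longrightarrow> eval Or f [y] z \<Longrightarrow> eval Or (Comp f [g]) xs z"
  by (rule eval_Comp[of "[y]"]) auto

lemma eval_Comp2:
  "eval Or g xs y \<Longrightarrow> eval Or h xs w \<Longrightarrow> eval Or f [y, w] z \<Longrightarrow> eval Or (Comp f [g, h]) xs z"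
  by (rule eval_Comp[of "[y, w]"]) (auto simp: less_Suc_eq)

primrec const_prog :: "nat \<Rightarrow> rf" where
  "const_prog 0 = Z"
| "const_prog (Suc n) = Comp S [const_prog n]"

lemma eval_const_prog: "eval Or (const_prog n) xs n"
  by (induction n) (auto intro!: eval_Z eval_Comp1 eval_S')

definition add_prog :: rf where "add_prog = Prec (Proj 0) (Comp S [Proj (Suc 0)])"

lemma eval_add_prog: "eval Or add_prog [x, y] (x + y)"
  unfolding add_prog_def
  by (induction x) (auto intro!: eval_Prec0 eval_PrecS eval_Proj' eval_Comp1 eval_S')

definition pred_prog :: rf where "pred_prog = Prec Z (Proj 0)"

lemma eval_pred_prog: "eval Or pred_prog [x] (x - 1)"
  unfolding pred_prog_def
  by (induction x) (auto intro!: eval_Prec0 eval_PrecS eval_Z eval_Proj')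

definition sub_prog :: rf where
  "sub_prog = Comp (Prec (Proj 0) (Comp pred_prog [Proj (Suc 0)])) [Proj (Suc 0), Proj 0]"

lemma eval_sub_prog: "eval Or sub_prog [x, y] (x - y)"
proof -
  have "eval Or (Prec (Proj 0) (Comp pred_prog [Proj (Suc 0)])) [y, x] (x - y)"
  proof (induction y)
    case (Suc y)
    show ?case
      using eval_pred_prog[of Or "x - y"]
      by (intro eval_PrecS[OF Suc] eval_Comp1[of _ _ _ "x - y"] eval_Proj') auto
  qed (auto intro!: eval_Prec0 eval_Proj')
  then show ?thesis
    unfolding sub_prog_def by (rule eval_Comp2[rotated 2]) (auto intro: eval_Proj')
qed

definition triangle_prog :: rf where
  "triangle_prog = Prec Z (Comp add_prog [Comp S [Proj 0], Proj (Suc 0)])"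

lemma eval_triangle_prog: "eval Or triangle_prog [x] (triangle x)"
proof (induction x)
  case 0
  then show ?case by (auto simp: triangle_prog_def intro!: eval_Prec0 eval_Z)
next
  case (Suc x)
  have "eval Or (Comp add_prog [Comp S [Proj 0], Proj (Suc 0)]) [x, triangle x] (Suc x + triangle x)"
    by (rule eval_Comp2[OF _ _ eval_add_prog]) (auto intro!: eval_Comp1 eval_S' eval_Proj')
  then show ?case
    using eval_PrecS[OF Suc[unfolded triangle_prog_def]] by (simp add: triangle_prog_def add.commute)
qed

definition pair_prog :: rf where
  "pair_prog = Comp add_prog [Comp triangle_prog [add_prog], Proj 0]"

lemma eval_pair_prog: "eval Or pair_prog [x, y] (prod_encode (x, y))"
  unfolding pair_prog_def prod_encode_def
  by (auto intro!: eval_Comp2[OF _ _ eval_add_prog] eval_Comp1[OF eval_add_prog eval_triangle_prog]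
      eval_Proj')

lemma triangle_mono: "m \<le> n \<Longrightarrow> triangle m \<le> triangle n"
  by (rule lift_Suc_mono_le) auto

text \<open>Inverting the Cantor pairing: the sum of the components of \<open>z\<close> is the least \<open>k\<close> with
  \<open>z < triangle (Suc k)\<close>.\<close>

definition diag_prog :: rf where
  "diag_prog = Mn (Comp sub_prog [Comp S [Proj (Suc 0)], Comp triangle_prog [Comp S [Proj 0]]])"

lemma eval_diag_prog: "eval Or diag_prog [prod_encode (a, b)] (a + b)"
proof -
  let ?f = "Comp sub_prog [Comp S [Proj (Suc 0)], Comp triangle_prog [Comp S [Proj 0]]]"
  have f: "eval Or ?f [k, z] (Suc z - triangle (Suc k))" for k z
    by (rule eval_Comp2[OF _ _ eval_sub_prog])
      (auto intro!: eval_Comp1[OF _ eval_triangle_prog] eval_Comp1[OF eval_Proj'] eval_S'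
        simp del: triangle_Suc)
  show ?thesis
    unfolding diag_prog_def
  proof (rule eval_Mn)
    show "eval Or ?f [a + b, prod_encode (a, b)] 0"
      using f[of "a + b" "prod_encode (a, b)"] by (simp add: prod_encode_def)
    show "\<forall>z<a + b. \<exists>v>0. eval Or ?f [z, prod_encode (a, b)] v"
    proof (intro allI impI)
      fix z assume "z < a + b"
      then have "triangle (Suc z) \<le> triangle (a + b)" by (intro triangle_mono) simp
      then have "Suc (prod_encode (a, b)) - triangle (Suc z) > 0"
        by (simp add: prod_encode_def del: triangle_Suc)
      then show "\<exists>v>0. eval Or ?f [z, prod_encode (a, b)] v" using f by blast
    qed
  qed
qed

text \<open>The Cantor code of \<open>(a, b)\<close> is \<open>triangle (a + b) + a\<close>:
  removing the triangle leaves \<open>a\<close>, and removing \<open>a\<close> from the diagonal sum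
  leaves \<open>b\<close>.\<close>

definition fst_prog :: rf where
  "fst_prog = Comp sub_prog [Proj 0, Comp triangle_prog [diag_prog]]"

definition snd_prog :: rf where
  "snd_prog = Comp sub_prog [diag_prog, fst_prog]"

lemma eval_fst_prog: "eval Or fst_prog [prod_encode (a, b)] a"
proof -
  have "eval Or fst_prog [prod_encode (a, b)] (prod_encode (a, b) - triangle (a + b))"
    unfolding fst_prog_def
    by (rule eval_Comp2[OF _ _ eval_sub_prog])
      (auto intro!: eval_Comp1[OF _ eval_triangle_prog] eval_diag_prog eval_Proj')
  then show ?thesis by (simp add: prod_encode_def)
qed

lemma eval_snd_prog: "eval Or snd_prog [prod_encode (a, b)] b"
  using eval_Comp2[OF eval_diag_prog eval_fst_prog eval_sub_prog, of Or a b]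
  by (simp add: snd_prog_def)

section \<open>Numbered types as carriers of recursive functions\<close>

class numbered =
  fixes gn :: "'a \<Rightarrow> nat"
  assumes gn_inj: "gn x = gn y \<Longrightarrow> x = y"

text \<open>Surjectivity makes every number decodable, so that a search over numbers can range over
  tuples, lists or derivations.\<close>

class fully_numbered = numbered +
  assumes gn_surj: "\<exists>x. gn x = n"

instantiation nat :: fully_numbered
begin
definition gn_nat :: "nat \<Rightarrow> nat" where [simp]: "gn_nat n = n"
instance by standard simp_all
end

instantiation bool :: numbered
begin
definition gn_bool :: "bool \<Rightarrow> nat" where [simp]: "gn_bool b = of_bool b"
instance by standard (simp split: if_splits add: of_bool_def)
end

instantiation prod :: (numbered, numbered) numbered
begin
definition gn_prod :: "'a \<times> 'b \<Rightarrow> nat" where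
  "gn_prod z = prod_encode (gn (fst z), gn (snd z))"
instance
proof
  fix x y :: "'a \<times> 'b"
  assume "gn x = gn y"
  then have "gn (fst x) = gn (fst y)" "gn (snd x) = gn (snd y)" by (simp_all add: gn_prod_def)
  then show "x = y" using gn_inj[of "fst x" "fst y"] gn_inj[of "snd x" "snd y"] by (simp add: prod_eqI)
qed
end

lemma gn_eq_iff: "gn x = gn y \<longleftrightarrow> x = y"
  by (rule iffI, erule gn_inj) simp

lemma gn_Pair: "gn (a, b) = prod_encode (gn a, gn b)"
  by (simp add: gn_prod_def)

instance prod :: (fully_numbered, fully_numbered) fully_numbered
proof
  fix n :: nat
  obtain x :: 'a where x: "gn x = fst (prod_decode n)" by (rule exE[OF gn_surj])
  obtain y :: 'b where y: "gn y = snd (prod_decode n)" by (rule exE[OF gn_surj])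
  have "gn (x, y) = n" by (simp add: gn_Pair x y)
  then show "\<exists>z :: 'a \<times> 'b. gn z = n" ..
qed

instantiation list :: (numbered) numbered
begin
definition gn_list :: "'a list \<Rightarrow> nat" where
  "gn_list xs = list_encode (map gn xs)"
instance
proof
  fix xs ys :: "'a list"
  assume "gn xs = gn ys"
  then have "list_decode (list_encode (map gn xs)) = list_decode (list_encode (map gn ys))"
    by (simp only: gn_list_def)
  then have "map gn xs = map gn ys"
    by simp
  moreover have "inj (gn :: 'a \<Rightarrow> nat)"
    by (rule injI) (rule gn_inj)
  ultimately show "xs = ys"
    by (rule map_injective)
qed
end

lemma gn_Nil [simp]: "gn [] = 0"
  by (simp add: gn_list_def)

lemma gn_Cons: "gn (x # xs) = Suc (gn (x, xs))"
  by (simp add: gn_list_def gn_prod_def)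

text \<open>Matches the list coding inside \<open>encode\<close>, so that the components of a
  program code can be read off with \<open>ungn\<close>.\<close>

lemma gn_nat_list: "gn (xs :: nat list) = list_encode xs"
proof -
  have "map gn xs = xs" by (induction xs) auto
  then show ?thesis by (simp add: gn_list_def)
qed

instance list :: (fully_numbered) fully_numbered
proof
  fix n :: nat
  let ?xs = "map (\<lambda>k. SOME x :: 'a. gn x = k) (list_decode n)"
  have "gn (SOME x :: 'a. gn x = k) = k" for k
    by (rule someI_ex) (rule gn_surj)
  then have "map gn ?xs = list_decode n"
    by (simp add: map_idI)
  then have "gn ?xs = n"
    unfolding gn_list_def by simp
  then show "\<exists>xs :: 'a list. gn xs = n" ..
qed

text \<open>The code itself is a recursive bound on the length; recursion on a list can thus become
  recursion on a number.\<close>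

lemma length_le_gn: "length xs \<le> gn xs"
proof (induction xs)
  case (Cons x xs)
  have "gn xs \<le> gn (x, xs)"
    by (simp add: gn_Pair le_prod_encode_2)
  with Cons show ?case by (simp add: gn_Cons)
qed simp

text \<open>One program has to serve all oracles, the nowhere defined one included, so it can be
  built into relativised searches and into computations from finite strings alike. Decidable
  predicates are the case of values in \<open>bool\<close>.\<close>

definition recursive :: "('a::numbered \<Rightarrow> 'b::numbered) \<Rightarrow> bool" where
  "recursive f \<longleftrightarrow> (\<exists>p. \<forall>Or a. eval Or p [gn a] (gn (f a)))"

section \<open>Closure properties of the recursive functions\<close>

named_theorems rec_intros

lemma recursiveI: "(\<And>Or a. eval Or p [gn a] (gn (f a))) \<Longrightarrow> recursive f"
  unfolding recursive_def by blast

lemma recursive_id [rec_intros]: "recursive (\<lambda>x. x)"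
  by (rule recursiveI[of "Proj 0"]) (simp add: eval_Proj')

lemma recursive_const [rec_intros]: "recursive (\<lambda>x. c)"
  by (rule recursiveI[of "const_prog (gn c)"]) (rule eval_const_prog)

lemma recursive_compose:
  assumes "recursive f" "recursive g"
  shows "recursive (\<lambda>x. f (g x))"
proof -
  obtain p q where "\<And>Or a. eval Or p [gn a] (gn (f a))" "\<And>Or a. eval Or q [gn a] (gn (g a))"
    using assms unfolding recursive_def by blast
  then show ?thesis by (intro recursiveI[of "Comp p [q]"] eval_Comp1)
qed

lemma recursive_Pair [rec_intros]:
  assumes "recursive f" "recursive g"
  shows "recursive (\<lambda>x. (f x, g x))"
proof -
  obtain p where p: "\<And>Or a. eval Or p [gn a] (gn (f a))"
    using assms(1) unfolding recursive_def by blast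
  obtain q where q: "\<And>Or a. eval Or q [gn a] (gn (g a))"
    using assms(2) unfolding recursive_def by blast
  show ?thesis
    by (rule recursiveI[of "Comp pair_prog [p, q]"])
      (simp add: gn_Pair eval_Comp2[OF p q eval_pair_prog])
qed

lemma recursive_compose2:
  assumes "recursive (\<lambda>z. F (fst z) (snd z))" "recursive f" "recursive g"
  shows "recursive (\<lambda>x. F (f x) (g x))"
  using recursive_compose[OF assms(1) recursive_Pair[OF assms(2,3)]] by simp

lemma recursive_fst [rec_intros]: "recursive f \<Longrightarrow> recursive (\<lambda>x. fst (f x))"
  by (rule recursive_compose[of fst, OF recursiveI[of fst_prog]])
    (simp add: gn_prod_def eval_fst_prog)

lemma recursive_snd [rec_intros]: "recursive f \<Longrightarrow> recursive (\<lambda>x. snd (f x))"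
  by (rule recursive_compose[of snd, OF recursiveI[of snd_prog]])
    (simp add: gn_prod_def eval_snd_prog)

lemma recursive_gn [rec_intros]: "recursive f \<Longrightarrow> recursive (\<lambda>x. gn (f x))"
  by (rule recursive_compose[of gn, OF recursiveI[of "Proj 0"]]) (simp add: eval_Proj')

text \<open>Injectivity makes the choice unique. On the level of codes this is the identity, so
  decoding costs only a projection.\<close>

definition ungn :: "nat \<Rightarrow> 'a::fully_numbered" where
  "ungn n = (SOME x. gn x = n)"

lemma gn_ungn [simp]: "gn (ungn n) = n"
  unfolding ungn_def by (rule someI_ex) (rule gn_surj)

lemma ungn_gn [simp]: "ungn (gn x) = x"
  by (rule gn_inj) simp

lemma recursive_ungn [rec_intros]: "recursive f \<Longrightarrow> recursive (\<lambda>x. ungn (f x))"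
  by (rule recursive_compose[of ungn, OF recursiveI[of "Proj 0"]]) (simp add: eval_Proj')

lemma recursive_Suc [rec_intros]: "recursive f \<Longrightarrow> recursive (\<lambda>x. Suc (f x))"
  by (rule recursive_compose[of Suc, OF recursiveI[of S]]) (simp add: eval_S')

lemma recursive_binary:
  assumes "\<And>Or m n. eval Or p [m, n] (F m n)" "recursive f" "recursive g"
  shows "recursive (\<lambda>x. F (f x) (g x) :: nat)"
proof (rule recursive_compose2[OF recursiveI[of "Comp p [fst_prog, snd_prog]"] assms(2,3)])
  fix Or and a :: "nat \<times> nat"
  show "eval Or (Comp p [fst_prog, snd_prog]) [gn a] (gn (F (fst a) (snd a)))"
    using eval_Comp2[OF eval_fst_prog eval_snd_prog assms(1), of Or "fst a" "snd a"]
    by (simp add: gn_prod_def)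
qed

lemma recursive_add [rec_intros]:
  "recursive f \<Longrightarrow> recursive g \<Longrightarrow> recursive (\<lambda>x. f x + g x :: nat)"
  by (rule recursive_binary[OF eval_add_prog])

lemma recursive_diff [rec_intros]:
  "recursive f \<Longrightarrow> recursive g \<Longrightarrow> recursive (\<lambda>x. f x - g x :: nat)"
  by (rule recursive_binary[OF eval_sub_prog])

lemma recursive_rec_nat [rec_intros]:
  assumes "recursive g" "recursive (\<lambda>z. s (fst z) (fst (snd z)) (snd (snd z)))" "recursive k"
  shows "recursive (\<lambda>x. rec_nat (g x) (s x) (k x))"
proof -
  obtain p q r where p: "\<And>Or a. eval Or p [gn a] (gn (g a))"
    and q: "\<And>Or a. eval Or q [gn a] (gn (s (fst a) (fst (snd a)) (snd (snd a))))"
    and r: "\<And>Or a. eval Or r [gn a] (k a)"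
    using assms unfolding recursive_def by (metis gn_nat_def)
  \<comment> \<open>\<open>Prec\<close> hands over counter, previous value and parameter in this
    order; \<open>q\<close> expects a single number coding parameter, counter and value.\<close>
  let ?q = "Comp q [Comp pair_prog [Proj 2, Comp pair_prog [Proj 0, Proj (Suc 0)]]]"
  have "eval Or ?q [i, gn y, gn x] (gn (s x i y))" for Or x i y
  proof (rule eval_Comp1)
    show "eval Or (Comp pair_prog [Proj 2, Comp pair_prog [Proj 0, Proj (Suc 0)]]) [i, gn y, gn x]
       (gn (x, (i, y)))"
      unfolding gn_Pair
      by (intro eval_Comp2[OF _ _ eval_pair_prog] eval_Proj') auto
    show "eval Or q [gn (x, (i, y))] (gn (s x i y))"
      using q[of Or "(x, i, y)"] by simp
  qed
  then have "eval Or (Prec p ?q) [n, gn x] (gn (rec_nat (g x) (s x) n))" for Or n x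
    by (induction n) (auto intro: eval_Prec0 eval_PrecS p)
  then show ?thesis
    by (intro recursiveI[of "Comp (Prec p ?q) [r, Proj 0]"] eval_Comp2[OF r eval_Proj']) auto
qed

lemma recursive_If [rec_intros]:
  assumes "recursive P" "recursive f" "recursive g"
  shows "recursive (\<lambda>x. if P x then f x else g x)"
proof -
  have "recursive (\<lambda>x. rec_nat (g x) (\<lambda>_ _. f x) (gn (P x)))"
    by (intro rec_intros assms recursive_compose[OF assms(2)])
  moreover have "(\<lambda>x. rec_nat (g x) (\<lambda>_ _. f x) (gn (P x))) = (\<lambda>x. if P x then f x else g x)"
    by auto
  ultimately show ?thesis by simp
qed

lemma recursive_not [rec_intros]:
  assumes "recursive P" shows "recursive (\<lambda>x. \<not> P x)"
proof -
  have "(\<lambda>x. \<not> P x) = (\<lambda>x. if P x then False else True)" by auto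
  then show ?thesis by (simp only:) (intro rec_intros assms)
qed

lemma recursive_conj [rec_intros]:
  assumes "recursive P" "recursive Q" shows "recursive (\<lambda>x. P x \<and> Q x)"
proof -
  have "(\<lambda>x. P x \<and> Q x) = (\<lambda>x. if P x then Q x else False)" by auto
  then show ?thesis by (simp only:) (intro rec_intros assms)
qed

lemma recursive_disj [rec_intros]:
  assumes "recursive P" "recursive Q" shows "recursive (\<lambda>x. P x \<or> Q x)"
proof -
  have "(\<lambda>x. P x \<or> Q x) = (\<lambda>x. if P x then True else Q x)" by auto
  then show ?thesis by (simp only:) (intro rec_intros assms)
qed

lemma recursive_less [rec_intros]:
  assumes "recursive f" "recursive g" shows "recursive (\<lambda>x. f x < (g x :: nat))"
proof -
  have "(\<lambda>x. f x < g x) = (\<lambda>x. rec_nat False (\<lambda>_ _. True) (g x - f x))"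
  proof
    fix x show "(f x < g x) = rec_nat False (\<lambda>_ _. True) (g x - f x)"
      by (cases "g x - f x") auto
  qed
  then show ?thesis by (simp only:) (intro rec_intros assms)
qed

lemma recursive_le [rec_intros]:
  assumes "recursive f" "recursive g" shows "recursive (\<lambda>x. f x \<le> (g x :: nat))"
  unfolding not_less[symmetric] by (intro rec_intros assms)

lemma recursive_eq [rec_intros]:
  assumes "recursive f" "recursive g" shows "recursive (\<lambda>x. f x = g x)"
proof -
  have "(\<lambda>x. f x = g x) = (\<lambda>x. gn (f x) \<le> gn (g x) \<and> gn (g x) \<le> gn (f x))"
    by (simp add: fun_eq_iff eq_iff[symmetric] gn_eq_iff)
  then show ?thesis by (simp only:) (intro rec_intros assms)
qed

lemma recursive_mult [rec_intros]:
  assumes "recursive f" "recursive g" shows "recursive (\<lambda>x. f x * g x :: nat)"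
proof -
  have "rec_nat 0 (\<lambda>_ r. r + n) m = m * n" for m n :: nat
    by (induction m) auto
  then have "(\<lambda>x. f x * g x) = (\<lambda>x. rec_nat 0 (\<lambda>_ r. r + g x) (f x))" by simp
  then show ?thesis
    by (simp only:) (intro rec_intros assms recursive_compose[OF assms(2)])
qed

text \<open>Unbounded search stays total because a witness is assumed for every argument.
  \<open>Mn\<close> looks for a zero, so truth is rendered as 0.\<close>

lemma recursive_Least:
  fixes P :: "'a::numbered \<Rightarrow> nat \<Rightarrow> bool"
  assumes "recursive (\<lambda>z. P (fst z) (snd z))" "\<And>x. \<exists>n. P x n"
  shows "recursive (\<lambda>x. LEAST n. P x n)"
proof -
  have "recursive (\<lambda>z. if P (fst z) (snd z) then 0 else Suc 0)"
    by (intro rec_intros assms(1))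
  then obtain p where p: "\<And>Or z. eval Or p [gn z] (if P (fst z) (snd z) then 0 else Suc 0)"
    unfolding recursive_def by (metis gn_nat_def)
  let ?q = "Comp p [Comp pair_prog [Proj (Suc 0), Proj 0]]"
  have q: "eval Or ?q [n, gn x] (if P x n then 0 else Suc 0)" for Or x n
  proof (rule eval_Comp1)
    show "eval Or (Comp pair_prog [Proj (Suc 0), Proj 0]) [n, gn x] (gn (x, n))"
      unfolding gn_Pair by (intro eval_Comp2[OF _ _ eval_pair_prog] eval_Proj') auto
    show "eval Or p [gn (x, n)] (if P x n then 0 else Suc 0)"
      using p[of Or "(x, n)"] by simp
  qed
  show ?thesis
  proof (rule recursiveI[of "Mn ?q"], unfold gn_nat_def, rule eval_Mn)
    fix Or x
    have "P x (LEAST n. P x n)" using assms(2) by (rule LeastI_ex)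
    then show "eval Or ?q [LEAST n. P x n, gn x] 0" using q[of Or "LEAST n. P x n" x] by simp
    show "\<forall>z<LEAST n. P x n. \<exists>v>0. eval Or ?q [z, gn x] v"
    proof (intro allI impI)
      fix z assume "z < (LEAST n. P x n)"
      then have "\<not> P x z" by (rule not_less_Least)
      then show "\<exists>v>0. eval Or ?q [z, gn x] v" using q[of Or z x] by auto
    qed
  qed
qed

lemma recursive_div [rec_intros]:
  assumes "recursive f" shows "recursive (\<lambda>x. f x div numeral c :: nat)"
proof -
  have "(LEAST q. n < numeral c * Suc q) = n div numeral c" for n :: nat
    by (rule Least_equality)
      (simp_all add: dividend_less_times_div less_mult_imp_div_less mult.commute flip: less_Suc_eq_le)
  moreover have "recursive (\<lambda>x. LEAST q. f x < numeral c * Suc q)"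
    by (rule recursive_Least)
      (intro rec_intros recursive_compose[OF assms], metis dividend_less_times_div mult_Suc_right add.commute zero_less_numeral)
  ultimately show ?thesis by simp
qed

lemma recursive_mod [rec_intros]:
  assumes "recursive f" shows "recursive (\<lambda>x. f x mod numeral c :: nat)"
  unfolding minus_mult_div_eq_mod[symmetric] by (intro rec_intros assms)

lemma recursive_odd [rec_intros]:
  assumes "recursive f" shows "recursive (\<lambda>x. odd (f x :: nat))"
  unfolding odd_iff_mod_2_eq_one by (intro rec_intros assms)

section \<open>Recursive operations on lists\<close>

lemma recursive_Cons [rec_intros]:
  assumes "recursive f" "recursive g" shows "recursive (\<lambda>x. f x # g x)"
proof (rule recursive_compose2[OF recursiveI assms])
  fix Or and z :: "'b \<times> 'b list"
  show "eval Or S [gn z] (gn (fst z # snd z))"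
    by (rule eval_S') (simp add: gn_Cons)
qed

text \<open>The code of a nonempty list is the successor of the code of the pair of head and tail,
  so one predecessor step delivers both. For the empty list the fixed, unspecified value
  \<open>hd []\<close> enters as a constant.\<close>

lemma recursive_hd_tl: "recursive (\<lambda>xs. (hd xs, tl xs))"
proof (rule recursiveI)
  fix Or and xs :: "'a list"
  have "eval Or (Prec (const_prog (gn (hd ([]::'a list), []::'a list))) (Proj 0)) [n]
      (case n of 0 \<Rightarrow> gn (hd ([]::'a list), []::'a list) | Suc m \<Rightarrow> m)" for n
    by (induction n) (auto intro!: eval_Prec0 eval_PrecS eval_const_prog eval_Proj')
  from this[of "gn xs"]
  show "eval Or (Prec (const_prog (gn (hd ([]::'a list), []::'a list))) (Proj 0)) [gn xs]
     (gn (hd xs, tl xs))"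
    by (cases xs) (auto simp: gn_Cons)
qed

lemma recursive_hd [rec_intros]: "recursive f \<Longrightarrow> recursive (\<lambda>x. hd (f x))"
  using recursive_fst[OF recursive_compose[OF recursive_hd_tl]] by simp

lemma recursive_tl [rec_intros]: "recursive f \<Longrightarrow> recursive (\<lambda>x. tl (f x))"
  using recursive_snd[OF recursive_compose[OF recursive_hd_tl]] by simp

text \<open>The loop idles once the list is used up, so any bound \<open>n\<close> on the length
  gives the right result; the code of the list will serve as \<open>n\<close>.\<close>

lemma fold_eq_rec_nat:
  assumes "length xs \<le> n"
  shows "fold f xs a = snd (rec_nat (xs, a)
    (\<lambda>_ r. if fst r = [] then r else (tl (fst r), f (hd (fst r)) (snd r))) n)"
proof -
  let ?s = "\<lambda>r. if fst r = [] then r else (tl (fst r), f (hd (fst r)) (snd r))"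
  have shift: "rec_nat z (\<lambda>_. ?s) (Suc n) = rec_nat (?s z) (\<lambda>_. ?s) n" for n z
    by (induction n) auto
  show ?thesis
    using assms
  proof (induction n arbitrary: xs a)
    case (Suc n)
    show ?case
    proof (cases xs)
      case Nil
      then have "rec_nat (xs, a) (\<lambda>_. ?s) m = (xs, a)" for m by (induction m) auto
      with Nil show ?thesis by simp
    next
      case (Cons y ys)
      with Suc have "fold f ys (f y a) = snd (rec_nat (ys, f y a) (\<lambda>_. ?s) n)" by simp
      with Cons shift[of "(xs, a)" n] show ?thesis by simp
    qed
  qed simp
qed

lemma recursive_fold [rec_intros]:
  assumes "recursive (\<lambda>z. f (fst z) (fst (snd z)) (snd (snd z)))" "recursive xs" "recursive a"
  shows "recursive (\<lambda>x. fold (f x) (xs x) (a x))"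
  unfolding fold_eq_rec_nat[OF length_le_gn]
  by (intro rec_intros assms(2,3)
      recursive_compose[OF assms(1), of "\<lambda>z. (fst z, hd (fst (snd (snd z))), snd (snd (snd z)))", simplified])

lemma recursive_rev [rec_intros]: "recursive xs \<Longrightarrow> recursive (\<lambda>x. rev (xs x))"
  unfolding rev_conv_fold by (intro rec_intros)

lemma recursive_append [rec_intros]:
  assumes "recursive xs" "recursive ys" shows "recursive (\<lambda>x. xs x @ ys x)"
proof -
  have "xs x @ ys x = fold (#) (rev (xs x)) (ys x)" for x
    by (simp add: fold_Cons_rev)
  then show ?thesis by (simp only:) (intro rec_intros assms)
qed

lemma recursive_map [rec_intros]:
  assumes "recursive (\<lambda>z. f (fst z) (snd z))" "recursive xs"
  shows "recursive (\<lambda>x. map (f x) (xs x))"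
proof -
  have "map g ys = fold (\<lambda>y r. r @ [g y]) ys []" for g :: "'b \<Rightarrow> 'c" and ys
    by (induction ys rule: rev_induct) auto
  then show ?thesis
    by (simp only:) (intro rec_intros assms(2)
        recursive_compose[OF assms(1), of "\<lambda>z. (fst z, fst (snd z))", simplified])
qed

lemma recursive_sum_list [rec_intros]:
  assumes "recursive xs" shows "recursive (\<lambda>x. sum_list (xs x) :: nat)"
proof -
  have "sum_list ys = fold (+) ys 0" for ys :: "nat list"
    by (simp add: fold_plus_sum_list_rev)
  then show ?thesis by (simp only:) (intro rec_intros assms)
qed

lemma recursive_Bex [rec_intros]:
  assumes "recursive (\<lambda>z. P (fst z) (snd z))" "recursive xs"
  shows "recursive (\<lambda>x. \<exists>y\<in>set (xs x). P x y)"
proof -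
  have "(\<exists>y\<in>set ys. Q y) = fold (\<lambda>y r. Q y \<or> r) ys False" for Q :: "'b \<Rightarrow> bool" and ys
    by (induction ys rule: rev_induct) auto
  then show ?thesis
    by (simp only:) (intro rec_intros assms(2)
        recursive_compose[OF assms(1), of "\<lambda>z. (fst z, fst (snd z))", simplified])
qed

lemma recursive_Ball [rec_intros]:
  assumes "recursive (\<lambda>z. P (fst z) (snd z))" "recursive xs"
  shows "recursive (\<lambda>x. \<forall>y\<in>set (xs x). P x y)"
proof -
  have "(\<forall>y\<in>set (xs x). P x y) = (\<not> (\<exists>y\<in>set (xs x). \<not> P x y))" for x by auto
  then show ?thesis by (simp only:) (intro rec_intros assms)
qed

lemma recursive_mem [rec_intros]:
  assumes "recursive f" "recursive xs" shows "recursive (\<lambda>x. f x \<in> set (xs x))"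
proof -
  have "(f x \<in> set (xs x)) = (\<exists>y\<in>set (xs x). y = f x)" for x by auto
  then show ?thesis by (simp only:) (intro rec_intros assms recursive_compose[OF assms(1)])
qed

lemma recursive_length [rec_intros]:
  assumes "recursive xs" shows "recursive (\<lambda>x. length (xs x))"
proof -
  have "length ys = sum_list (map (\<lambda>_. 1) ys)" for ys :: "'b list"
    by (induction ys) auto
  then show ?thesis by (simp only:) (intro rec_intros assms)
qed

lemma recursive_upt [rec_intros]:
  assumes "recursive f" shows "recursive (\<lambda>x. [0..<f x])"
proof -
  have "[0..<n] = rec_nat [] (\<lambda>i r. r @ [i]) n" for n by (induction n) auto
  then show ?thesis by (simp only:) (intro rec_intros assms)
qed

lemma recursive_drop [rec_intros]:
  assumes "recursive n" "recursive xs" shows "recursive (\<lambda>x. drop (n x) (xs x))"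
proof -
  have "drop k ys = rec_nat ys (\<lambda>_. tl) k" for k and ys :: "'b list"
    by (induction k) (auto simp: drop_Suc simp flip: tl_drop)
  then show ?thesis by (simp only:) (intro rec_intros assms)
qed

lemma recursive_arg [rec_intros]:
  assumes "recursive i" "recursive xs" shows "recursive (\<lambda>x. arg (i x) (xs x))"
proof -
  have "arg k ys = (if k < length ys then hd (drop k ys) else 0)" for k ys
    by (simp add: arg_def hd_drop_conv_nth)
  then show ?thesis by (simp only:) (intro rec_intros assms)
qed

text \<open>List access made total by False beyond the end, where \<open>nth\<close> has no
  specified value.\<close>

definition bit_at :: "bool list \<Rightarrow> nat \<Rightarrow> bool" where
  "bit_at \<sigma> i \<longleftrightarrow> i < length \<sigma> \<and> \<sigma> ! i"

lemma recursive_bit_at [rec_intros]: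
  assumes "recursive s" "recursive i" shows "recursive (\<lambda>x. bit_at (s x) (i x))"
proof -
  have "bit_at \<sigma> k = (if k < length \<sigma> then hd (drop k \<sigma>) else False)" for \<sigma> k
    by (auto simp: bit_at_def hd_drop_conv_nth)
  then show ?thesis by (simp only:) (intro rec_intros assms)
qed

section \<open>Recognising computations\<close>

lemma eval_deterministic: "eval Or p xs v \<Longrightarrow> eval Or p xs w \<Longrightarrow> v = w"
proof (induction arbitrary: w rule: eval.induct)
  case (eval_Comp ys gs xs f z)
  from eval_Comp.prems obtain ys' where ys': "length ys' = length gs"
    "\<forall>i<length gs. eval Or (gs ! i) xs (ys' ! i)" "eval Or f ys' w"
    by (cases rule: eval.cases) auto
  with eval_Comp have "ys = ys'" by (intro nth_equalityI) auto
  with ys' eval_Comp.IH show ?case by blast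
next
  case (eval_Prec0 f ys z g)
  from eval_Prec0.prems show ?case
    by (cases rule: eval.cases) (auto intro: eval_Prec0.IH)
next
  case (eval_PrecS f g x ys y z)
  from eval_PrecS.prems obtain y' where "eval Or (Prec f g) (x # ys) y'" "eval Or g (x # y' # ys) w"
    by (cases rule: eval.cases) auto
  with eval_PrecS.IH show ?case by blast
next
  case (eval_Mn f y xs)
  from eval_Mn.prems have w: "eval Or f (w # xs) 0" "\<forall>z<w. \<exists>v>0. eval Or f (z # xs) v"
    by (cases rule: eval.cases; auto)+
  show ?case
  proof (cases y w rule: linorder_cases)
    case less
    with w eval_Mn.IH show ?thesis by fastforce
  next
    case greater
    with w eval_Mn.IH show ?thesis by fastforce
  qed
qed (auto elim: eval.cases)

lemma eval_Orc': "Or (arg 0 xs) = Some b \<Longrightarrow> v = of_bool b \<Longrightarrow> eval Or Orc xs v"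
  using eval_Orc[of Or xs b] by (cases b) auto

lemma eval_mono:
  "eval Or p xs v \<Longrightarrow> (\<And>n b. Or n = Some b \<Longrightarrow> Or' n = Some b) \<Longrightarrow> eval Or' p xs v"
proof (induction rule: eval.induct)
  case (eval_Comp ys gs xs f z)
  then show ?case by (intro eval.eval_Comp[of ys]) auto
next
  case (eval_Mn f y xs)
  then show ?case by (intro eval.eval_Mn) blast+
next
  case (eval_Orc xs b)
  then show ?case by (intro eval_Orc'[of _ _ b]) auto
qed (auto intro: eval.intros)

lemma list_encode_eq_iff: "list_encode xs = list_encode ys \<longleftrightarrow> xs = ys"
  by (metis list_encode_inverse)

text \<open>Residues modulo 7 separate the constructors; within one residue the pairing and list
  codings are injective.\<close>

lemma encode_injective: "encode p = encode q \<Longrightarrow> p = q"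
proof (induction p arbitrary: q)
  case (Comp f gs)
  from Comp.prems obtain f' gs' where q: "q = Comp f' gs'" "encode f = encode f'"
    "map encode gs = map encode gs'"
    by (cases q) (auto simp: list_encode_eq_iff, presburger+)
  then have "gs = gs'"
    by (metis Comp.IH(2) map_eq_imp_length_eq nth_equalityI nth_map nth_mem)
  with q Comp.IH(1) show ?case by simp
next
  case (Prec f g)
  then show ?case by (cases q) (auto, presburger+)
next
  case (Mn f)
  then show ?case by (cases q) (auto, presburger+)
next
  case (Proj i)
  then show ?case by (cases q) (auto, presburger+)
next
  case Z
  then show ?case by (cases q) simp_all
next
  case S
  then show ?case by (cases q) simp_all
next
  case Orc
  then show ?case by (cases q) simp_all
qed

section \<open>Finite prefixes of a set and the use principle\<close>

definition restrict :: "nat set \<Rightarrow> nat \<Rightarrow> bool list" where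
  "restrict A l = map (\<lambda>i. i \<in> A) [0..<l]"

lemma length_restrict [simp]: "length (restrict A l) = l"
  by (simp add: restrict_def)

lemma bit_at_restrict [simp]: "bit_at (restrict A l) i \<longleftrightarrow> i < l \<and> i \<in> A"
  by (auto simp: restrict_def bit_at_def)

lemma str_oracle_restrict: "str_oracle (restrict A l) n = (if n < l then Some (n \<in> A) else None)"
  by (simp add: str_oracle_def restrict_def)

lemma eval_restrict_imp_eval: "eval (str_oracle (restrict A l)) p xs v \<Longrightarrow> eval (set_oracle A) p xs v"
  by (erule eval_mono) (auto simp: str_oracle_restrict set_oracle_def split: if_splits)

text \<open>A halting computation consults only finitely many bits. The form with "eventually" lets
  the demands of finitely many subcomputations combine without explicit maxima.\<close>

lemma eval_imp_eventually_eval_restrict: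
  assumes "eval (set_oracle A) p xs v"
  shows "\<forall>\<^sub>F l in sequentially. eval (str_oracle (restrict A l)) p xs v"
  using assms
proof (induction rule: eval.induct)
  case (eval_Orc xs b)
  show ?case
    using eventually_gt_at_top[of "arg 0 xs"]
    by eventually_elim
      (use eval_Orc in \<open>auto simp: set_oracle_def str_oracle_restrict intro!: eval_Orc'[of _ _ b]\<close>)
next
  case (eval_Comp ys gs xs f z)
  then have "\<forall>\<^sub>F l in sequentially. \<forall>i\<in>{..<length gs}. eval (str_oracle (restrict A l)) (gs ! i) xs (ys ! i)"
    by (intro eventually_ball_finite) auto
  with eval_Comp.IH(2) show ?case
    by eventually_elim (use eval_Comp.hyps in \<open>auto intro!: eval.eval_Comp[of ys]\<close>)
next
  case (eval_PrecS f g x ys y z)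
  from eval_PrecS.IH show ?case by eventually_elim (auto intro: eval.intros)
next
  case (eval_Prec0 f ys z g)
  from eval_Prec0.IH show ?case by eventually_elim (auto intro: eval.intros)
next
  case (eval_Mn f y xs)
  have "\<forall>\<^sub>F l in sequentially. \<forall>z\<in>{..<y}. \<exists>v>0. eval (str_oracle (restrict A l)) f (z # xs) v"
  proof (intro eventually_ball_finite ballI)
    fix z assume "z \<in> {..<y}"
    with eval_Mn.IH obtain v where "0 < v" "\<forall>\<^sub>F l in sequentially. eval (str_oracle (restrict A l)) f (z # xs) v"
      by auto
    then show "\<forall>\<^sub>F l in sequentially. \<exists>v>0. eval (str_oracle (restrict A l)) f (z # xs) v"
      by (auto elim: eventually_mono)
  qed simp
  with eval_Mn.IH(1) show ?case
    by eventually_elim (auto intro!: eval.eval_Mn)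
qed (intro always_eventually allI eval.intros)+

text \<open>A judgement \<open>(e, xs, v)\<close> claims that the program with code \<open>e\<close> maps \<open>xs\<close> to \<open>v\<close>. A list of
  judgements each of which follows by one evaluation rule from others of the list is sound, without
  any ordering of the list, because every rule passes to a subprogram or decreases the first
  argument of a primitive recursion.\<close>

type_synonym judgement = "nat \<times> nat list \<times> nat"

definition justified_Comp :: "judgement list \<Rightarrow> nat list \<Rightarrow> nat \<Rightarrow> nat \<times> nat list \<Rightarrow> bool" where
  "justified_Comp D xs v c \<longleftrightarrow> (\<exists>t\<in>set D. fst t = fst c \<and> snd (snd t) = v \<and>
     length (fst (snd t)) = length (snd c) \<and>
     (\<forall>i\<in>set [0..<length (snd c)]. (arg i (snd c), xs, arg i (fst (snd t))) \<in> set D))"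

definition justified_Prec :: "judgement list \<Rightarrow> nat \<Rightarrow> nat list \<Rightarrow> nat \<Rightarrow> nat \<times> nat \<Rightarrow> bool" where
  "justified_Prec D e xs v c \<longleftrightarrow> xs \<noteq> [] \<and>
     (if hd xs = 0 then (fst c, tl xs, v) \<in> set D
      else (\<exists>t\<in>set D. fst t = e \<and> fst (snd t) = (hd xs - 1) # tl xs \<and>
        (snd c, (hd xs - 1) # snd (snd t) # tl xs, v) \<in> set D))"

definition justified_Mn :: "judgement list \<Rightarrow> nat list \<Rightarrow> nat \<Rightarrow> nat \<Rightarrow> bool" where
  "justified_Mn D xs v c \<longleftrightarrow> (c, v # xs, 0) \<in> set D \<and>
     (\<forall>z\<in>set [0..<v]. \<exists>t\<in>set D. fst t = c \<and> fst (snd t) = z # xs \<and> 0 < snd (snd t))"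

text \<open>The residues are those of \<open>encode\<close>, and \<open>ungn\<close> unpacks the
  quotient. A query beyond the string is never justified, in accordance with
  \<open>str_oracle\<close>. The list occurs only positively, so derivations can be merged
  freely.\<close>

definition justified :: "bool list \<Rightarrow> judgement list \<Rightarrow> judgement \<Rightarrow> bool" where
  "justified \<sigma> D t \<longleftrightarrow>
     fst t = 0 \<and> snd (snd t) = 0 \<or>
     fst t = 1 \<and> snd (snd t) = Suc (arg 0 (fst (snd t))) \<or>
     fst t = 2 \<and> arg 0 (fst (snd t)) < length \<sigma> \<and> snd (snd t) = gn (bit_at \<sigma> (arg 0 (fst (snd t)))) \<or>
     fst t mod 7 = 3 \<and> snd (snd t) = arg (fst t div 7) (fst (snd t)) \<or>
     fst t mod 7 = 4 \<and> justified_Comp D (fst (snd t)) (snd (snd t)) (ungn (fst t div 7)) \<or>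
     fst t mod 7 = 5 \<and> justified_Prec D (fst t) (fst (snd t)) (snd (snd t)) (ungn (fst t div 7)) \<or>
     fst t mod 7 = 6 \<and> justified_Mn D (fst (snd t)) (snd (snd t)) (fst t div 7)"

definition valid :: "bool list \<Rightarrow> judgement list \<Rightarrow> bool" where
  "valid \<sigma> D \<longleftrightarrow> (\<forall>t\<in>set D. justified \<sigma> D t)"

lemma recursive_justified_Comp [rec_intros]:
  assumes "recursive D" "recursive xs" "recursive v" "recursive c"
  shows "recursive (\<lambda>x. justified_Comp (D x) (xs x) (v x) (c x))"
  unfolding justified_Comp_def by (intro rec_intros assms assms[THEN recursive_compose])

lemma recursive_justified_Prec [rec_intros]:
  assumes "recursive D" "recursive e" "recursive xs" "recursive v" "recursive c"
  shows "recursive (\<lambda>x. justified_Prec (D x) (e x) (xs x) (v x) (c x))"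
  unfolding justified_Prec_def by (intro rec_intros assms assms[THEN recursive_compose])

lemma recursive_justified_Mn [rec_intros]:
  assumes "recursive D" "recursive xs" "recursive v" "recursive c"
  shows "recursive (\<lambda>x. justified_Mn (D x) (xs x) (v x) (c x))"
  unfolding justified_Mn_def by (intro rec_intros assms assms[THEN recursive_compose])

lemma recursive_valid [rec_intros]:
  assumes "recursive s" "recursive D"
  shows "recursive (\<lambda>x. valid (s x) (D x))"
  unfolding valid_def justified_def by (intro rec_intros assms assms[THEN recursive_compose])

lemma justified_mono: "justified \<sigma> D t \<Longrightarrow> set D \<subseteq> set D' \<Longrightarrow> justified \<sigma> D' t"
  unfolding justified_def justified_Comp_def justified_Prec_def justified_Mn_def
  by (elim disjE; (simp split: if_splits)?; blast)

lemma valid_append: "valid \<sigma> D \<Longrightarrow> valid \<sigma> E \<Longrightarrow> valid \<sigma> (D @ E)"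
  unfolding valid_def by (metis Un_iff justified_mono set_append sup_ge1 sup_ge2)

lemma valid_concat: "(\<And>D. D \<in> set Ds \<Longrightarrow> valid \<sigma> D) \<Longrightarrow> valid \<sigma> (concat Ds)"
  by (induction Ds) (auto intro: valid_append, simp add: valid_def)

lemma valid_Cons: "valid \<sigma> D \<Longrightarrow> justified \<sigma> D t \<Longrightarrow> valid \<sigma> (t # D)"
  unfolding valid_def by (metis justified_mono set_ConsD set_subset_Cons)

lemma valid_restrict_mono:
  assumes "valid (restrict A l) D" "l \<le> m" shows "valid (restrict A m) D"
proof -
  have "justified (restrict A m) D t" if "justified (restrict A l) D t" for t
    using that assms(2) unfolding justified_def length_restrict bit_at_restrict
    by (elim disjE; simp)
  with assms(1) show ?thesis by (simp add: valid_def)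
qed

lemma ungn_encode_Comp:
  "ungn (encode (Comp f gs) div 7) = (encode f, map encode gs)"
proof -
  have "encode (Comp f gs) div 7 = gn (encode f, map encode gs)"
    by (simp add: gn_Pair gn_nat_list)
  then show ?thesis by (simp only: ungn_gn)
qed

lemma ungn_encode_Prec: "ungn (encode (Prec f g) div 7) = (encode f, encode g)"
proof -
  have "encode (Prec f g) div 7 = gn (encode f, encode g)"
    by (simp add: gn_Pair)
  then show ?thesis by (simp only: ungn_gn)
qed

lemma justified_encode:
  "justified \<sigma> D (encode Z, xs, v) \<longleftrightarrow> v = 0"
  "justified \<sigma> D (encode S, xs, v) \<longleftrightarrow> v = Suc (arg 0 xs)"
  "justified \<sigma> D (encode Orc, xs, v) \<longleftrightarrow> arg 0 xs < length \<sigma> \<and> v = gn (bit_at \<sigma> (arg 0 xs))"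
  "justified \<sigma> D (encode (Proj i), xs, v) \<longleftrightarrow> v = arg i xs"
  "justified \<sigma> D (encode (Comp f gs), xs, v) \<longleftrightarrow> justified_Comp D xs v (encode f, map encode gs)"
  "justified \<sigma> D (encode (Prec f g), xs, v) \<longleftrightarrow>
     justified_Prec D (encode (Prec f g)) xs v (encode f, encode g)"
  "justified \<sigma> D (encode (Mn f), xs, v) \<longleftrightarrow> justified_Mn D xs v (encode f)"
proof -
  show "justified \<sigma> D (encode (Comp f gs), xs, v) \<longleftrightarrow> justified_Comp D xs v (encode f, map encode gs)"
    using ungn_encode_Comp[of f gs] by (simp add: justified_def)
  show "justified \<sigma> D (encode (Prec f g), xs, v) \<longleftrightarrow>
     justified_Prec D (encode (Prec f g)) xs v (encode f, encode g)"
    using ungn_encode_Prec[of f g] by (simp add: justified_def)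
qed (simp_all add: justified_def)

lemma valid_sound:
  assumes "valid \<sigma> D" "(encode p, xs, v) \<in> set D"
  shows "eval (str_oracle \<sigma>) p xs v"
  using assms(2)
proof (induction p arbitrary: xs v)
  have just: "justified \<sigma> D (encode p, xs, v)" if "(encode p, xs, v) \<in> set D" for p xs v
    using assms(1) that by (simp add: valid_def)
  {
    case (Comp f gs)
    from just[OF Comp.prems] obtain t where t: "t \<in> set D" "fst t = encode f" "snd (snd t) = v"
      "length (fst (snd t)) = length gs"
      "\<forall>i<length gs. (encode (gs ! i), xs, fst (snd t) ! i) \<in> set D"
      unfolding justified_encode justified_Comp_def by (force simp: arg_def)
    then have "(encode f, fst (snd t), v) \<in> set D"
      by (metis prod.collapse)
    then show ?case
      using t by (intro eval_Comp[of "fst (snd t)"] Comp.IH(1)) (simp_all add: Comp.IH(2))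
  next
    case (Prec f g)
    have "eval (str_oracle \<sigma>) (Prec f g) (n # xs) v" if "(encode (Prec f g), n # xs, v) \<in> set D" for n xs v
      using that
    proof (induction n arbitrary: v)
      case 0
      from just[OF 0] have "(encode f, xs, v) \<in> set D"
        unfolding justified_encode by (simp add: justified_Prec_def)
      then show ?case by (intro eval_Prec0 Prec.IH)
    next
      case (Suc n)
      from just[OF Suc.prems] obtain y where "(encode (Prec f g), n # xs, y) \<in> set D"
        "(encode g, n # y # xs, v) \<in> set D"
        unfolding justified_encode by (auto simp: justified_Prec_def simp del: encode.simps)
      then show ?case by (intro eval_PrecS[of _ _ _ n xs y] Suc.IH Prec.IH)
    qed
    moreover have "xs \<noteq> []"
      using just[OF Prec.prems] unfolding justified_encode by (simp add: justified_Prec_def)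
    ultimately show ?case using Prec.prems by (cases xs) auto
  next
    case (Mn f)
    from just[OF Mn.prems] have D: "(encode f, v # xs, 0) \<in> set D"
      and *: "\<forall>z\<in>set [0..<v]. \<exists>t\<in>set D. fst t = encode f \<and> fst (snd t) = z # xs \<and> 0 < snd (snd t)"
      unfolding justified_encode justified_Mn_def by blast+
    have "\<exists>u. 0 < u \<and> (encode f, z # xs, u) \<in> set D" if "z < v" for z
      using * that by (metis atLeastLessThan_iff le0 prod.collapse set_upt)
    with D show ?case
      by (intro eval_Mn) (use Mn.IH in blast)+
  next
    case Orc
    from just[OF Orc] have "arg 0 xs < length \<sigma>" "v = of_bool (\<sigma> ! arg 0 xs)"
      unfolding justified_encode by (auto simp: bit_at_def)
    then show ?case
      by (intro eval_Orc'[of _ _ "\<sigma> ! arg 0 xs"]) (auto simp: str_oracle_def)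
  next
    case Z
    from just[OF Z] show ?case unfolding justified_encode by (simp add: eval_Z)
  next
    case S
    from just[OF S] show ?case unfolding justified_encode by (simp add: eval_S)
  next
    case (Proj i)
    from just[OF Proj] show ?case unfolding justified_encode by (simp add: eval_Proj)
  }
qed

lemma valid_complete:
  assumes "eval (str_oracle \<sigma>) p xs v"
  shows "\<exists>D. valid \<sigma> D \<and> (encode p, xs, v) \<in> set D"
proof -
  have step: "\<exists>D. valid \<sigma> D \<and> t \<in> set D" if "valid \<sigma> D" "justified \<sigma> D t" for D t
    using valid_Cons[OF that] by (meson list.set_intros(1))
  have nil: "valid \<sigma> []" by (simp add: valid_def)
  show ?thesis
    using assms
  proof (induction rule: eval.induct)
    case (eval_Orc xs b)
    then show ?case
      by (intro step[OF nil], unfold justified_encode)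
        (auto simp: str_oracle_def bit_at_def split: if_splits)
  next
    case (eval_Comp ys gs xs f z)
    obtain E where E: "\<And>i. i < length gs \<Longrightarrow> valid \<sigma> (E i) \<and> (encode (gs ! i), xs, ys ! i) \<in> set (E i)"
      using eval_Comp.IH(1) by metis
    obtain F where F: "valid \<sigma> F" "(encode f, ys, z) \<in> set F"
      using eval_Comp.IH(2) by blast
    let ?D = "F @ concat (map E [0..<length gs])"
    have "(arg i (map encode gs), xs, arg i ys) \<in> set ?D" if "i < length gs" for i
      using E[OF that] that eval_Comp.hyps by (auto simp: arg_def)
    then have "justified_Comp ?D xs z (encode f, map encode gs)"
      using F(2) eval_Comp.hyps unfolding justified_Comp_def
      by (intro bexI[of _ "(encode f, ys, z)"]) auto
    moreover have "valid \<sigma> ?D"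
      using E F by (intro valid_append valid_concat) auto
    ultimately show ?case
      using step[of ?D "(encode (Comp f gs), xs, z)"] by (simp only: justified_encode)
  next
    case (eval_Prec0 f ys z g)
    then obtain D where "valid \<sigma> D" "(encode f, ys, z) \<in> set D" by blast
    then show ?case
      using step[of D "(encode (Prec f g), 0 # ys, z)"]
      by (simp only: justified_encode justified_Prec_def) simp
  next
    case (eval_PrecS f g x ys y z)
    then obtain D E where D: "valid \<sigma> D" "(encode (Prec f g), x # ys, y) \<in> set D"
      and E: "valid \<sigma> E" "(encode g, x # y # ys, z) \<in> set E" by blast
    have "justified_Prec (D @ E) (encode (Prec f g)) (Suc x # ys) z (encode f, encode g)"
      using D(2) E(2) unfolding justified_Prec_def
      by (auto simp del: encode.simps intro!: bexI[of _ "(encode (Prec f g), x # ys, y)"])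
    with valid_append[OF D(1) E(1)] show ?case
      using step[of "D @ E" "(encode (Prec f g), Suc x # ys, z)"] by (simp only: justified_encode)
  next
    case (eval_Mn f y xs)
    then obtain F where F: "valid \<sigma> F" "(encode f, y # xs, 0) \<in> set F" by blast
    have "\<forall>z<y. \<exists>v. 0 < v \<and> (\<exists>D. valid \<sigma> D \<and> (encode f, z # xs, v) \<in> set D)"
      using eval_Mn.IH(2) by blast
    then obtain u E where E: "\<And>z. z < y \<Longrightarrow> 0 < u z \<and> valid \<sigma> (E z) \<and> (encode f, z # xs, u z) \<in> set (E z)"
      by metis
    let ?D = "F @ concat (map E [0..<y])"
    have "\<exists>t\<in>set ?D. fst t = encode f \<and> fst (snd t) = z # xs \<and> 0 < snd (snd t)" if "z < y" for z
      using E[OF that] that by (intro bexI[of _ "(encode f, z # xs, u z)"]) auto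
    then have "justified_Mn ?D xs y (encode f)"
      using F(2) unfolding justified_Mn_def by simp
    moreover have "valid \<sigma> ?D"
      using E F by (intro valid_append valid_concat) auto
    ultimately show ?case
      using step[of ?D "(encode (Mn f), xs, y)"] by (simp only: justified_encode)
  qed (rule step[OF nil], simp only: justified_encode)+
qed

text \<open>A valid derivation does not certify that its codes belong to programs: a primitive
  recursion started at 0 never inspects its step program. Membership in a list closed under
  components certifies this decidably.\<close>

definition code_list :: "nat list \<Rightarrow> bool" where
  "code_list K \<longleftrightarrow> (\<forall>k\<in>set K. k < 3 \<or> k mod 7 = 3 \<or>
     k mod 7 = 4 \<and> (let c = ungn (k div 7) :: nat \<times> nat list in
       fst c \<in> set K \<and> (\<forall>g\<in>set (snd c). g \<in> set K)) \<or>
     k mod 7 = 5 \<and> (let c = ungn (k div 7) :: nat \<times> nat in fst c \<in> set K \<and> snd c \<in> set K) \<or>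
     k mod 7 = 6 \<and> k div 7 \<in> set K)"

lemma recursive_code_list [rec_intros]:
  assumes "recursive K" shows "recursive (\<lambda>x. code_list (K x))"
  unfolding code_list_def Let_def by (intro rec_intros assms assms[THEN recursive_compose])

lemma code_list_append: "code_list K \<Longrightarrow> code_list L \<Longrightarrow> code_list (K @ L)"
  unfolding code_list_def Let_def by auto

lemma code_list_concat: "(\<And>K. K \<in> set Ks \<Longrightarrow> code_list K) \<Longrightarrow> code_list (concat Ks)"
  by (induction Ks) (auto intro: code_list_append, simp add: code_list_def)

text \<open>Components are strictly smaller than the code containing them, so the closed list admits
  no circular appeal.\<close>

lemma code_list_sound:
  assumes "code_list K" "k \<in> set K"
  shows "\<exists>p. encode p = k"
  using assms(2)
proof (induction k rule: less_induct)
  case (less k)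
  have eq: "k = 7 * (k div 7) + k mod 7" by simp
  from assms(1) less.prems consider "k < 3" | "k mod 7 = 3"
    | c :: "nat \<times> nat list" where "k mod 7 = 4" "c = ungn (k div 7)" "fst c \<in> set K"
        "\<forall>g\<in>set (snd c). g \<in> set K"
    | c :: "nat \<times> nat" where "k mod 7 = 5" "c = ungn (k div 7)" "fst c \<in> set K" "snd c \<in> set K"
    | "k mod 7 = 6" "k div 7 \<in> set K"
    unfolding code_list_def Let_def by blast
  then show ?case
  proof cases
    case 1
    then have "k = encode Z \<or> k = encode S \<or> k = encode Orc" by auto
    then show ?thesis by blast
  next
    case 2
    with eq have "encode (Proj (k div 7)) = k" by simp
    then show ?thesis ..
  next
    case 3
    have k: "k = 4 + 7 * prod_encode (fst c, list_encode (snd c))"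
      using eq 3 by (metis add.commute gn_Pair gn_nat_def gn_nat_list gn_ungn prod.collapse)
    have "prod_encode (fst c, list_encode (snd c)) < k"
      using k by linarith
    then have small: "fst c < k" "list_encode (snd c) < k"
      using le_prod_encode_1[of "fst c" "list_encode (snd c)"]
        le_prod_encode_2[of "list_encode (snd c)" "fst c"] by linarith+
    obtain f where f: "encode f = fst c" using less.IH 3 small by blast
    have "\<exists>p. encode p = g" if "g \<in> set (snd c)" for g
    proof -
      have "g < list_encode xs" if "g \<in> set xs" for xs
        using that
      proof (induction xs)
        case (Cons x xs)
        then show ?case
          using le_prod_encode_1[of x "list_encode xs"] le_prod_encode_2[of "list_encode xs" x]
          by (auto simp: less_Suc_eq_le)
      qed simp
      then have "g < k" using that small by (meson less_trans)
      then show ?thesis using less.IH 3 that by blast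
    qed
    then have "\<forall>g\<in>set (snd c). \<exists>p. g = encode p" by metis
    then obtain gs where "snd c = map encode gs" unfolding ex_map_conv[symmetric] ..
    with k f have "encode (Comp f gs) = k" by simp
    then show ?thesis ..
  next
    case 4
    have k: "k = 5 + 7 * prod_encode (fst c, snd c)"
      using eq 4 by (metis add.commute gn_Pair gn_nat_def gn_ungn prod.collapse)
    have "prod_encode (fst c, snd c) < k"
      using k by linarith
    then have "fst c < k" "snd c < k"
      using le_prod_encode_1[of "fst c" "snd c"] le_prod_encode_2[of "snd c" "fst c"] by linarith+
    then obtain f g where "encode f = fst c" "encode g = snd c" using less.IH 4 by blast
    with k have "encode (Prec f g) = k" by simp
    then show ?thesis ..
  next
    case 5
    have "k div 7 < k" using 5 by (intro div_less_dividend) auto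
    then obtain f where "encode f = k div 7" using less.IH 5 by blast
    with eq 5 have "encode (Mn f) = k" by simp
    then show ?thesis ..
  qed
qed

lemma code_list_complete: "\<exists>K. code_list K \<and> encode p \<in> set K"
proof (induction p)
  case (Comp f gs)
  obtain K where K: "code_list K" "encode f \<in> set K" using Comp.IH(1) by blast
  obtain L where L: "\<And>g. g \<in> set gs \<Longrightarrow> code_list (L g) \<and> encode g \<in> set (L g)"
    using Comp.IH(2) by metis
  let ?K = "K @ concat (map L gs)"
  have "code_list ?K" using K L by (intro code_list_append code_list_concat) auto
  moreover have "fst (ungn (encode (Comp f gs) div 7) :: nat \<times> nat list) \<in> set ?K"
    "\<forall>g\<in>set (snd (ungn (encode (Comp f gs) div 7) :: nat \<times> nat list)). g \<in> set ?K"
    unfolding ungn_encode_Comp using K L by auto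
  moreover have "encode (Comp f gs) mod 7 = 4" by simp
  ultimately have "code_list (encode (Comp f gs) # ?K)"
    unfolding code_list_def Let_def by (auto simp del: encode.simps)
  then show ?case by (meson list.set_intros(1))
next
  case (Prec f g)
  obtain K L where K: "code_list K" "encode f \<in> set K" "code_list L" "encode g \<in> set L"
    using Prec.IH by blast
  have "code_list (K @ L)" using K by (intro code_list_append)
  moreover have "fst (ungn (encode (Prec f g) div 7) :: nat \<times> nat) \<in> set (K @ L)"
    "snd (ungn (encode (Prec f g) div 7) :: nat \<times> nat) \<in> set (K @ L)"
    unfolding ungn_encode_Prec using K by auto
  moreover have "encode (Prec f g) mod 7 = 5" by simp
  ultimately have "code_list (encode (Prec f g) # K @ L)"
    unfolding code_list_def Let_def by (auto simp del: encode.simps)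
  then show ?case by (meson list.set_intros(1))
next
  case (Mn f)
  then obtain K where K: "code_list K" "encode f \<in> set K" by blast
  then have "code_list (encode (Mn f) # K)"
    unfolding code_list_def Let_def by auto
  then show ?case by (meson list.set_intros(1))
next
  case (Proj i)
  have "code_list [encode (Proj i)]" by (simp add: code_list_def)
  then show ?case by (meson list.set_intros(1))
next
  case Z
  have "code_list [encode Z]" by (simp add: code_list_def)
  then show ?case by (meson list.set_intros(1))
next
  case S
  have "code_list [encode S]" by (simp add: code_list_def)
  then show ?case by (meson list.set_intros(1))
next
  case Orc
  have "code_list [encode Orc]" by (simp add: code_list_def)
  then show ?case by (meson list.set_intros(1))
qed

text \<open>Kleene's predicate for finite oracles: \<open>w\<close> is a certificate, coding a
  closed list of program codes together with a derivation.\<close>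

definition computes :: "bool list \<Rightarrow> nat \<Rightarrow> nat \<Rightarrow> nat list \<Rightarrow> nat \<Rightarrow> bool" where
  "computes \<sigma> w e xs v \<longleftrightarrow> (let W = ungn w :: nat list \<times> judgement list in
     code_list (fst W) \<and> valid \<sigma> (snd W) \<and> e \<in> set (fst W) \<and> (e, xs, v) \<in> set (snd W))"

text \<open>The value is sought inside the derivation; this bounded quantifier keeps convergence
  with a given certificate recursive.\<close>

definition converges :: "bool list \<Rightarrow> nat \<Rightarrow> nat \<Rightarrow> nat list \<Rightarrow> bool" where
  "converges \<sigma> w e xs \<longleftrightarrow> (let W = ungn w :: nat list \<times> judgement list in
     code_list (fst W) \<and> valid \<sigma> (snd W) \<and> e \<in> set (fst W) \<and>
     (\<exists>t\<in>set (snd W). fst t = e \<and> fst (snd t) = xs))"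

lemma converges_iff: "converges \<sigma> w e xs \<longleftrightarrow> (\<exists>v. computes \<sigma> w e xs v)"
  unfolding converges_def computes_def Let_def by (auto intro!: bexI)

lemma recursive_computes [rec_intros]:
  assumes "recursive s" "recursive w" "recursive e" "recursive xs" "recursive v"
  shows "recursive (\<lambda>x. computes (s x) (w x) (e x) (xs x) (v x))"
  unfolding computes_def Let_def by (intro rec_intros assms assms[THEN recursive_compose])

lemma recursive_converges [rec_intros]:
  assumes "recursive s" "recursive w" "recursive e" "recursive xs"
  shows "recursive (\<lambda>x. converges (s x) (w x) (e x) (xs x))"
  unfolding converges_def Let_def by (intro rec_intros assms assms[THEN recursive_compose])

lemma computes_sound:
  assumes "computes \<sigma> w e xs v"
  obtains p where "encode p = e" "eval (str_oracle \<sigma>) p xs v"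
  using assms code_list_sound valid_sound unfolding computes_def Let_def by blast

lemma computes_complete:
  assumes "eval (str_oracle \<sigma>) p xs v"
  shows "\<exists>w. computes \<sigma> w (encode p) xs v"
proof -
  obtain D where D: "valid \<sigma> D" "(encode p, xs, v) \<in> set D" using valid_complete[OF assms] by blast
  obtain K where K: "code_list K" "encode p \<in> set K" using code_list_complete by blast
  have "computes \<sigma> (gn (K, D)) (encode p) xs v"
    using D K unfolding computes_def Let_def ungn_gn by simp
  then show ?thesis ..
qed

lemma computes_restrict_mono:
  "computes (restrict A l) w e xs v \<Longrightarrow> l \<le> m \<Longrightarrow> computes (restrict A m) w e xs v"
  unfolding computes_def Let_def by (auto intro: valid_restrict_mono)

section \<open>Truth tables\<close>

text \<open>\<open>u\<close> bounds the use and \<open>t\<close> is the table, a recursive predicate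
  that decides on every string, not only on prefixes of \<open>B\<close>.\<close>

definition table_le :: "nat set \<Rightarrow> nat set \<Rightarrow> bool" where
  "table_le A B \<longleftrightarrow> (\<exists>u t. recursive u \<and> recursive t \<and> (\<forall>n. n \<in> A \<longleftrightarrow> t (n, restrict B (u n))))"

lemma table_leI:
  assumes "recursive u" "recursive (\<lambda>z. t (fst z) (snd z))" "\<And>n. n \<in> A \<longleftrightarrow> t n (restrict B (u n))"
  shows "table_le A B"
  unfolding table_le_def
  by (rule exI[of _ u], rule exI[of _ "\<lambda>z. t (fst z) (snd z)"]) (use assms in simp)

lemma chi_eq_gn: "chi A n = gn (n \<in> A)"
  by (simp add: chi_def)

lemma recursive_imp_computable: "recursive (f :: nat \<Rightarrow> nat) \<Longrightarrow> computable f"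
  unfolding recursive_def computable_def by auto

text \<open>A computation that halts with the nowhere defined oracle goes through with every oracle
  by monotonicity.\<close>

lemma computable_imp_recursive:
  assumes "computable f" shows "recursive f"
proof -
  obtain q where "\<And>n. eval (\<lambda>_. None) q [n] (f n)" using assms unfolding computable_def by blast
  then have "eval Or q [n] (f n)" for Or n by (rule eval_mono) simp
  then show ?thesis by (intro recursiveI[of q]) simp
qed

lemma table_le_imp_tt_le:
  assumes "table_le A B" shows "tt_le A B"
proof -
  obtain u t where ut: "recursive u" "recursive t" "\<And>n. n \<in> A \<longleftrightarrow> t (n, restrict B (u n))"
    using assms unfolding table_le_def by blast
  obtain pu where pu: "\<And>Or n. eval Or pu [n] (u n)"
    using ut(1) unfolding recursive_def by auto
  obtain pt where pt: "\<And>Or z. eval Or pt [gn z] (gn (t z))"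
    using ut(2) unfolding recursive_def by blast
  obtain pr where pr: "\<And>Or (xs :: bool list). eval Or pr [gn xs] (gn (rev xs))"
    using recursive_rev[OF recursive_id] unfolding recursive_def by blast
  \<comment> \<open>Successor after pairing is the coding of a nonempty list, so this conses the bit
    at the current position. The newest bit comes first, hence the later reversal by
    \<open>pr\<close>.\<close>
  let ?step = "Comp S [Comp pair_prog [Comp Orc [Proj 0], Proj (Suc 0)]]"
  let ?p = "Comp pt [Comp pair_prog [Proj 0, Comp pr [Comp (Prec Z ?step) [pu]]]]"
  have collect: "eval Or (Prec Z ?step) [m] (gn (rev (map b [0..<m])))"
    if "\<And>i. i < m \<Longrightarrow> Or i = Some (b i)" for Or b m
    using that
  proof (induction m)
    case 0
    then show ?case by (auto intro: eval_Prec0 eval_Z)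
  next
    case (Suc m)
    let ?r = "gn (rev (map b [0..<m]))"
    have "eval Or ?step [m, ?r] (Suc (prod_encode (of_bool (b m), ?r)))"
      using Suc.prems[of m]
      by (intro eval_Comp1[OF eval_Comp2[OF _ _ eval_pair_prog]] eval_S' eval_Comp1[OF eval_Proj']
          eval_Orc'[of _ _ "b m"] eval_Proj') auto
    then have "eval Or (Prec Z ?step) [Suc m] (Suc (prod_encode (of_bool (b m), ?r)))"
      using Suc by (intro eval_PrecS[of _ _ _ m "[]" ?r]) auto
    then show ?case by (simp add: gn_Cons gn_Pair)
  qed
  have main: "eval Or ?p [n] (gn (t (n, map b [0..<u n])))"
    if "\<And>i. i < u n \<Longrightarrow> Or i = Some (b i)" for Or b n
  proof -
    have "eval Or (Comp pr [Comp (Prec Z ?step) [pu]]) [n] (gn (map b [0..<u n]))"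
      using eval_Comp1[OF eval_Comp1[OF pu collect[OF that]] pr] by simp
    then have "eval Or (Comp pair_prog [Proj 0, Comp pr [Comp (Prec Z ?step) [pu]]]) [n]
        (gn (n, map b [0..<u n]))"
      unfolding gn_Pair by (intro eval_Comp2[OF eval_Proj' _ eval_pair_prog]) auto
    then show ?thesis by (rule eval_Comp1[OF _ pt])
  qed
  have "tt_functional ?p"
    unfolding tt_functional_def
  proof (intro exI[of _ u] conjI allI impI)
    fix n and \<sigma> :: "bool list" assume "length \<sigma> = u n"
    then show "\<exists>v. eval (str_oracle \<sigma>) ?p [n] v"
      using main[of n "str_oracle \<sigma>" "\<lambda>i. \<sigma> ! i"] by (auto simp: str_oracle_def)
  qed (rule recursive_imp_computable[OF ut(1)])
  moreover have "eval (set_oracle B) ?p [n] (chi A n)" for n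
    using main[of n "set_oracle B" "\<lambda>i. i \<in> B"] ut(3)[of n]
    by (simp add: set_oracle_def chi_eq_gn restrict_def)
  ultimately show ?thesis unfolding tt_le_def by blast
qed

text \<open>Convergence on all strings of length \<open>f n\<close>, wrong ones included, makes the
  search for a halting certificate total; the table then checks whether the certified value is
  1.\<close>

lemma tt_le_imp_table_le:
  assumes "tt_le A B" shows "table_le A B"
proof -
  obtain p f where p: "\<And>n. eval (set_oracle B) p [n] (chi A n)" and f: "computable f"
    and conv: "\<And>n \<sigma>. length \<sigma> = f n \<Longrightarrow> \<exists>v. eval (str_oracle \<sigma>) p [n] v"
    using assms unfolding tt_le_def tt_functional_def by blast
  have rec_f: "recursive f" using f by (rule computable_imp_recursive)
  \<comment> \<open>The table must also be total on strings of other lengths. They are truncated, or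
    padded with False, to the length at which convergence is guaranteed.\<close>
  define cut where "cut z = map (bit_at (snd z)) [0..<f (fst z)]" for z :: "nat \<times> bool list"
  have rec_cut: "recursive cut"
    unfolding cut_def by (intro rec_intros recursive_compose[OF rec_f])
  define wit where "wit z = (LEAST w. converges (cut z) w (encode p) [fst z])" for z
  have ex: "\<exists>w. converges (cut z) w (encode p) [fst z]" for z
  proof -
    have "length (cut z) = f (fst z)" by (simp add: cut_def)
    then show ?thesis using conv computes_complete unfolding converges_iff by blast
  qed
  have rec_wit: "recursive wit"
    unfolding wit_def by (rule recursive_Least[OF _ ex]) (intro rec_intros recursive_compose[OF rec_cut])
  show ?thesis
  proof (rule table_leI[OF rec_f])
    let ?t = "\<lambda>n \<sigma>. computes (cut (n, \<sigma>)) (wit (n, \<sigma>)) (encode p) [n] 1"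
    show "recursive (\<lambda>z. ?t (fst z) (snd z))"
      by (intro rec_intros recursive_compose[OF rec_cut] recursive_compose[OF rec_wit])
    fix n
    let ?z = "(n, restrict B (f n))"
    have cut: "cut ?z = restrict B (f n)"
      by (auto simp: cut_def restrict_def bit_at_def)
    have val: "v = chi A n" if v: "computes (restrict B (f n)) w (encode p) [n] v" for w v
    proof -
      obtain p' where "encode p' = encode p" "eval (str_oracle (restrict B (f n))) p' [n] v"
        using computes_sound[OF v] by blast
      then have "eval (str_oracle (restrict B (f n))) p [n] v"
        using encode_injective by blast
      then show ?thesis
        using eval_deterministic[OF eval_restrict_imp_eval p] by blast
    qed
    have "converges (cut ?z) (wit ?z) (encode p) [n]"
      using LeastI_ex[OF ex[of ?z]] by (simp add: wit_def)
    then obtain v where "computes (restrict B (f n)) (wit ?z) (encode p) [n] v"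
      unfolding converges_iff cut by blast
    with val show "n \<in> A \<longleftrightarrow> ?t n (restrict B (f n))"
      unfolding cut by (metis chi_def zero_neq_one)
  qed
qed

lemma tt_le_iff_table_le: "tt_le A B \<longleftrightarrow> table_le A B"
  using table_le_imp_tt_le tt_le_imp_table_le by blast

lemma table_le_vimage:
  assumes "recursive g" shows "table_le {n. g n \<in> B} B"
proof (rule table_leI)
  show "recursive (\<lambda>n. Suc (g n))" by (intro rec_intros assms)
  show "recursive (\<lambda>z :: nat \<times> bool list. bit_at (snd z) (g (fst z)))"
    by (intro rec_intros recursive_compose[OF assms])
qed simp

lemma table_le_refl: "table_le A A"
  using table_le_vimage[OF recursive_id, of A] by simp

lemma table_le_trans:
  assumes "table_le A B" "table_le B C" shows "table_le A C"
proof -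
  obtain u t where ut: "recursive u" "recursive t" "\<And>n. n \<in> A \<longleftrightarrow> t (n, restrict B (u n))"
    using assms(1) unfolding table_le_def by blast
  obtain u' t' where ut': "recursive u'" "recursive t'" "\<And>n. n \<in> B \<longleftrightarrow> t' (n, restrict C (u' n))"
    using assms(2) unfolding table_le_def by blast
  show ?thesis
  proof (rule table_leI)
    let ?u = "\<lambda>n. sum_list (map u' [0..<u n])"
    let ?t = "\<lambda>n \<sigma>. t (n, map (\<lambda>i. t' (i, map (bit_at \<sigma>) [0..<u' i])) [0..<u n])"
    show "recursive ?u"
      by (intro rec_intros ut(1) recursive_compose[OF ut'(1)])
    show "recursive (\<lambda>z. ?t (fst z) (snd z))"
      by (rule recursive_compose[OF ut(2)])
        (intro rec_intros recursive_compose[OF ut(1)] recursive_compose[OF ut'(1)] recursive_compose[OF ut'(2)])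
    fix n
    have "map (bit_at (restrict C (?u n))) [0..<u' i] = restrict C (u' i)" if "i < u n" for i
    proof -
      have "u' i \<le> ?u n"
        using that by (intro member_le_sum_list) auto
      then show ?thesis by (auto simp: restrict_def bit_at_def)
    qed
    then have "map (\<lambda>i. t' (i, map (bit_at (restrict C (?u n))) [0..<u' i])) [0..<u n] = restrict B (u n)"
      by (simp add: restrict_def[of B] ut'(3))
    then show "n \<in> A \<longleftrightarrow> ?t n (restrict C (?u n))" by (simp add: ut(3))
  qed
qed

lemma mem_join: "n \<in> join A B \<longleftrightarrow> (if odd n then n div 2 \<in> B else n div 2 \<in> A)"
proof -
  have "2 * k \<in> join A B \<longleftrightarrow> k \<in> A" "Suc (2 * k) \<in> join A B \<longleftrightarrow> k \<in> B" for k
    unfolding join_def by (auto, presburger+)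
  then show ?thesis by (cases "odd n") (auto elim!: evenE oddE)
qed

lemma table_le_join:
  assumes "table_le A C" "table_le B C" shows "table_le (join A B) C"
proof -
  obtain u t where ut: "recursive u" "recursive t" "\<And>n. n \<in> A \<longleftrightarrow> t (n, restrict C (u n))"
    using assms(1) unfolding table_le_def by blast
  obtain u' t' where ut': "recursive u'" "recursive t'" "\<And>n. n \<in> B \<longleftrightarrow> t' (n, restrict C (u' n))"
    using assms(2) unfolding table_le_def by blast
  show ?thesis
  proof (rule table_leI)
    let ?u = "\<lambda>n. if odd n then u' (n div 2) else u (n div 2)"
    let ?t = "\<lambda>n \<sigma>. if odd n then t' (n div 2, \<sigma>) else t (n div 2, \<sigma>)"
    show "recursive ?u"
      by (intro rec_intros recursive_compose[OF ut(1)] recursive_compose[OF ut'(1)])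
    show "recursive (\<lambda>z. ?t (fst z) (snd z))"
      by (intro rec_intros recursive_compose[OF ut(2)] recursive_compose[OF ut'(2)])
    show "n \<in> join A B \<longleftrightarrow> ?t n (restrict C (?u n))" for n
      by (simp add: mem_join ut(3) ut'(3))
  qed
qed

lemma table_le_join_left: "table_le A (join A B)"
proof -
  have "recursive (\<lambda>n :: nat. 2 * n)" by (intro rec_intros)
  from table_le_vimage[OF this, of "join A B"] show ?thesis by (simp add: mem_join)
qed

lemma table_le_join_right: "table_le B (join A B)"
proof -
  have "recursive (\<lambda>n :: nat. Suc (2 * n))" by (intro rec_intros)
  from table_le_vimage[OF this, of "join A B"] show ?thesis by (simp add: mem_join)
qed

text \<open>Queries may depend on earlier answers: as only one bit is learnt per step, the finitely many
  states reachable by step \<open>i\<close> can be listed, which bounds the use.\<close>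

lemma table_le_adaptive:
  fixes h :: "nat \<Rightarrow> 's::numbered"
  assumes q: "recursive (\<lambda>z. q (fst z) (snd z))"
    and upd: "recursive (\<lambda>z. upd (fst z) (fst (snd z)) (snd (snd z)))"
    and h: "\<And>i. h (Suc i) = upd i (h i) (i \<in> A)"
    and A: "\<And>i. i \<in> A \<longleftrightarrow> q i (h i) \<in> B"
  shows "table_le A B"
proof -
  define states where
    "states i = rec_nat [h 0] (\<lambda>i hs. map (\<lambda>s. upd i s False) hs @ map (\<lambda>s. upd i s True) hs) i" for i
  note rec_q = recursive_compose[OF q, of "\<lambda>x. (f x, g x)" for f g, simplified]
  note rec_upd = recursive_compose[OF upd, of "\<lambda>x. (f x, g x, k x)" for f g k, simplified]
  have rec_states: "recursive states"
    unfolding states_def by (intro rec_intros rec_upd)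
  have h_states: "h i \<in> set (states i)" for i
  proof (induction i)
    case (Suc i)
    then show ?case by (cases "i \<in> A") (auto simp: states_def h)
  qed (simp add: states_def)
  show ?thesis
  proof (rule table_leI)
    \<comment> \<open>The sum dominates every query at a listed state up to and including step
      \<open>n\<close>; the outer \<open>Suc\<close> makes the prefix contain the queried bit
      itself.\<close>
    let ?u = "\<lambda>n. Suc (sum_list (map (\<lambda>i. sum_list (map (q i) (states i))) [0..<Suc n]))"
    let ?run = "\<lambda>\<sigma>. rec_nat (h 0) (\<lambda>i s. upd i s (bit_at \<sigma> (q i s)))"
    show "recursive ?u"
      by (intro rec_intros rec_q recursive_compose[OF rec_states])
    show "recursive (\<lambda>z. bit_at (snd z) (q (fst z) (?run (snd z) (fst z))))"
      by (intro rec_intros rec_q rec_upd)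
    fix n
    have use: "q i (h i) < ?u n" if "i \<le> n" for i
    proof -
      have "q i (h i) \<le> sum_list (map (q i) (states i))"
        using h_states by (intro member_le_sum_list) auto
      also have "\<dots> \<le> sum_list (map (\<lambda>i. sum_list (map (q i) (states i))) [0..<Suc n])"
        using that by (intro member_le_sum_list) (auto simp del: upt_Suc)
      finally show ?thesis by simp
    qed
    have "?run (restrict B (?u n)) i = h i" if "i \<le> n" for i
      using that by (induction i) (use use in \<open>simp_all add: h A del: upt_Suc\<close>)
    then show "n \<in> A \<longleftrightarrow> bit_at (restrict B (?u n)) (q n (?run (restrict B (?u n)) n))"
      using use[of n] by (simp add: A del: upt_Suc)
  qed
qed

section \<open>Uniform search programs\<close>

lemma recursive_encode_const_prog [rec_intros]:
  assumes "recursive f" shows "recursive (\<lambda>x. encode (const_prog (f x)))"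
proof -
  \<comment> \<open>\<open>4 + 7 * ...\<close> codes a composition, and the 1 inside is the code of
    \<open>S\<close>.\<close>
  have "encode (const_prog n) = rec_nat 0 (\<lambda>_ c. 4 + 7 * gn (1 :: nat, [c])) n" for n
    by (induction n) (simp_all add: gn_Pair gn_nat_list)
  then show ?thesis by (simp only:) (intro rec_intros assms)
qed

text \<open>An s-m-n theorem for search loops: the parameter is built in as a constant program, so
  the code depends recursively on it. Each test may use one oracle bit, at a position computed
  beforehand.\<close>

lemma search_program:
  fixes q :: "'a::numbered \<Rightarrow> nat \<Rightarrow> nat \<Rightarrow> nat"
  assumes q: "recursive (\<lambda>z. q (fst z) (fst (snd z)) (snd (snd z)))"
    and test: "recursive (\<lambda>z. test (fst z) (fst (snd z)) (fst (snd (snd z))) (snd (snd (snd z))))"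
  obtains g :: "'a \<Rightarrow> nat" where "recursive g"
    "\<And>a. \<exists>p. encode p = g a \<and> (\<forall>A x v. eval (set_oracle A) p [x] v \<longleftrightarrow>
       test a x v (q a x v \<in> A) \<and> (\<forall>u<v. \<not> test a x u (q a x u \<in> A)))"
proof -
  obtain pq where pq: "\<And>Or a x v. eval Or pq [gn (a, x, v)] (q a x v)"
    using q unfolding recursive_def by fastforce
  have "recursive (\<lambda>z. if test (fst (fst z)) (fst (snd (fst z))) (snd (snd (fst z))) (snd z) then 0 else Suc 0)"
    by (intro rec_intros recursive_compose[OF test,
        of "\<lambda>z. (fst (fst z), fst (snd (fst z)), snd (snd (fst z)), snd z)", simplified])
  then obtain pt where pt:
    "\<And>Or a x v b. eval Or pt [gn ((a, x, v), b)] (if test a x v b then 0 else Suc 0)"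
    unfolding recursive_def by fastforce
  let ?c = "Comp pair_prog [Proj (Suc 0), Comp pair_prog [Proj 2, Proj 0]]"
  let ?b = "Comp pt [Comp pair_prog [?c, Comp Orc [Comp pq [?c]]]]"
  define p where "p a = Comp (Mn ?b) [const_prog (gn a), Proj 0]" for a :: 'a
  \<comment> \<open>The entry 3 is the code of \<open>Proj 0\<close>, which passes on the input
    unchanged.\<close>
  define g where "g a = 4 + 7 * gn (encode (Mn ?b), [encode (const_prog (gn a)), 3])" for a :: 'a
  have c: "eval Or ?c [v, gn a, x] (gn (a, x, v))" for Or v x and a :: 'a
    unfolding gn_Pair by (intro eval_Comp2[OF _ _ eval_pair_prog] eval_Proj') auto
  have b: "eval (set_oracle A) ?b [v, gn a, x] (if test a x v (q a x v \<in> A) then 0 else Suc 0)" for A v a x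
  proof (rule eval_Comp1[OF _ pt])
    have "eval (set_oracle A) (Comp Orc [Comp pq [?c]]) [v, gn a, x] (gn (q a x v \<in> A))"
      by (rule eval_Comp1[OF eval_Comp1[OF c pq]], rule eval_Orc') (auto simp: set_oracle_def)
    then show "eval (set_oracle A) (Comp pair_prog [?c, Comp Orc [Comp pq [?c]]]) [v, gn a, x]
      (gn ((a, x, v), q a x v \<in> A))"
      using eval_Comp2[OF c _ eval_pair_prog] unfolding gn_Pair by blast
  qed
  have mn: "eval (set_oracle A) (Mn ?b) [gn a, x] v \<longleftrightarrow>
      test a x v (q a x v \<in> A) \<and> (\<forall>u<v. \<not> test a x u (q a x u \<in> A))" (is "_ \<longleftrightarrow> ?least v") for A a x v
  proof
    assume "eval (set_oracle A) (Mn ?b) [gn a, x] v"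
    then have 0: "eval (set_oracle A) ?b [v, gn a, x] 0"
      and pos: "\<forall>u<v. \<exists>w>0. eval (set_oracle A) ?b [u, gn a, x] w"
      by (cases rule: eval.cases; simp)+
    show "?least v"
    proof (intro conjI allI impI)
      show "test a x v (q a x v \<in> A)"
        using eval_deterministic[OF b 0] by (simp split: if_splits)
      fix u assume "u < v"
      then obtain w where "0 < w" and w: "eval (set_oracle A) ?b [u, gn a, x] w" using pos by blast
      then show "\<not> test a x u (q a x u \<in> A)"
        using eval_deterministic[OF b w] by (simp split: if_splits)
    qed
  next
    assume least: "?least v"
    then have "eval (set_oracle A) ?b [v, gn a, x] 0"
      using b[of A v a x] by simp
    moreover have "eval (set_oracle A) ?b [u, gn a, x] (Suc 0)" if "u < v" for u
      using b[of A u a x] least that by simp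
    ultimately show "eval (set_oracle A) (Mn ?b) [gn a, x] v"
      by (intro eval_Mn allI impI exI conjI) auto
  qed
  have "eval (set_oracle A) (p a) [x] v \<longleftrightarrow> eval (set_oracle A) (Mn ?b) [gn a, x] v" for A a x v
  proof
    assume "eval (set_oracle A) (p a) [x] v"
    then obtain ys where ys: "length ys = 2" "eval (set_oracle A) (const_prog (gn a)) [x] (ys ! 0)"
      "eval (set_oracle A) (Proj 0) [x] (ys ! 1)" "eval (set_oracle A) (Mn ?b) ys v"
      unfolding p_def by (cases rule: eval.cases) (auto simp: less_Suc_eq numeral_2_eq_2)
    have "ys ! 0 = gn a" "ys ! 1 = x"
      using eval_deterministic[OF ys(2) eval_const_prog] eval_deterministic[OF ys(3) eval_Proj] by auto
    with ys(1) have "ys = [gn a, x]"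
      by (intro nth_equalityI) (auto simp: less_Suc_eq numeral_2_eq_2)
    with ys show "eval (set_oracle A) (Mn ?b) [gn a, x] v" by simp
  next
    assume "eval (set_oracle A) (Mn ?b) [gn a, x] v"
    then show "eval (set_oracle A) (p a) [x] v"
      unfolding p_def by (intro eval_Comp2[OF eval_const_prog eval_Proj']) auto
  qed
  moreover have "encode (p a) = g a" for a
    by (simp add: p_def g_def gn_Pair gn_nat_list)
  moreover have "recursive g"
    unfolding g_def by (intro rec_intros)
  ultimately show thesis using that[of g] mn by blast
qed

text \<open>The jump is many-one complete, uniformly in the oracle, for existential statements whose
  matrix reads one oracle bit. The program built here ignores its input, so running it on its own
  code is harmless.\<close>

lemma jump_search:
  fixes q :: "'a::numbered \<Rightarrow> nat \<Rightarrow> nat"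
  assumes "recursive (\<lambda>z. q (fst z) (snd z))"
    and "recursive (\<lambda>z. test (fst z) (fst (snd z)) (snd (snd z)))"
  obtains g :: "'a \<Rightarrow> nat" where "recursive g"
    "\<And>a A. g a \<in> jump A \<longleftrightarrow> (\<exists>s. test a s (q a s \<in> A))"
proof -
  have q: "recursive (\<lambda>z :: 'a \<times> nat \<times> nat. q (fst z) (snd (snd z)))"
    using recursive_compose[OF assms(1), of "\<lambda>z :: 'a \<times> nat \<times> nat. (fst z, snd (snd z))"]
    by (simp add: rec_intros)
  have t: "recursive (\<lambda>z :: 'a \<times> nat \<times> nat \<times> bool. test (fst z) (fst (snd (snd z))) (snd (snd (snd z))))"
    using recursive_compose[OF assms(2), of "\<lambda>z :: 'a \<times> nat \<times> nat \<times> bool. (fst z, fst (snd (snd z)), snd (snd (snd z)))"]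
    by (simp add: rec_intros)
  obtain g :: "'a \<Rightarrow> nat" where g: "recursive g"
    "\<And>a. \<exists>p. encode p = g a \<and> (\<forall>A x v. eval (set_oracle A) p [x] v \<longleftrightarrow>
       test a v (q a v \<in> A) \<and> (\<forall>u<v. \<not> test a u (q a u \<in> A)))"
    using search_program[of "\<lambda>a x v. q a v" "\<lambda>a x v b. test a v b", OF q t] by blast
  have "g a \<in> jump A \<longleftrightarrow> (\<exists>s. test a s (q a s \<in> A))" for a A
  proof -
    obtain p where p: "encode p = g a" "\<forall>A x v. eval (set_oracle A) p [x] v \<longleftrightarrow>
       test a v (q a v \<in> A) \<and> (\<forall>u<v. \<not> test a u (q a u \<in> A))"
      using g(2)[of a] by (elim exE conjE)
    have "encode p' = g a \<longleftrightarrow> p' = p" for p'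
      using p(1) encode_injective[of p' p] by auto
    then have "g a \<in> jump A \<longleftrightarrow> (\<exists>v. eval (set_oracle A) p [g a] v)"
      by (simp add: jump_def)
    also have "\<dots> \<longleftrightarrow> (\<exists>s. test a s (q a s \<in> A))"
      using exists_least_iff[of "\<lambda>s. test a s (q a s \<in> A)"] p(2) by simp
    finally show ?thesis .
  qed
  with g(1) that show thesis by blast
qed

section \<open>Classes defined by forbidden elements of the jump\<close>

text \<open>The effectively closed classes are coded by finite lists \<open>h\<close>, standing for
  \<open>{A. jump A \<inter> set h = {}}\<close>.\<close>

definition killed :: "nat set \<Rightarrow> bool list \<Rightarrow> bool" where
  "killed H \<sigma> \<longleftrightarrow> (\<exists>w\<in>set [0..<length \<sigma>]. \<exists>n\<in>H. converges \<sigma> w n [n])"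

lemma recursive_killed [rec_intros]:
  assumes "recursive h" "recursive s"
  shows "recursive (\<lambda>x. killed (set (h x)) (s x))"
  unfolding killed_def by (intro rec_intros assms assms[THEN recursive_compose])

lemma killed_restrict_mono: "killed H (restrict A l) \<Longrightarrow> l \<le> m \<Longrightarrow> killed H (restrict A m)"
  unfolding killed_def converges_iff length_restrict set_upt
  by (meson atLeastLessThan_iff computes_restrict_mono le_trans less_le_trans)

lemma mem_jump_iff: "n \<in> jump A \<longleftrightarrow> (\<exists>w l. converges (restrict A l) w n [n])"
proof
  assume "n \<in> jump A"
  then obtain p v where p: "encode p = n" "eval (set_oracle A) p [n] v"
    unfolding jump_def by blast
  from eval_imp_eventually_eval_restrict[OF p(2)]
  obtain l where "eval (str_oracle (restrict A l)) p [n] v"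
    unfolding eventually_sequentially by blast
  then have "\<exists>w. computes (restrict A l) w n [n] v"
    using computes_complete p(1) by blast
  then show "\<exists>w l. converges (restrict A l) w n [n]"
    unfolding converges_iff by blast
next
  assume "\<exists>w l. converges (restrict A l) w n [n]"
  then obtain w l v where "computes (restrict A l) w n [n] v"
    unfolding converges_iff by blast
  then obtain p where "encode p = n" "eval (str_oracle (restrict A l)) p [n] v"
    by (rule computes_sound)
  then show "n \<in> jump A"
    unfolding jump_def using eval_restrict_imp_eval by blast
qed

text \<open>Bounding certificates by the length of the string makes \<open>killed\<close> decidable
  for finite \<open>H\<close>. Nothing is lost in the limit, since a prefix can be lengthened until
  it covers the queries and exceeds the certificate.\<close>

lemma killed_restrict_iff: "(\<exists>l. killed H (restrict A l)) \<longleftrightarrow> jump A \<inter> H \<noteq> {}"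
proof
  assume "\<exists>l. killed H (restrict A l)"
  then obtain l w n where "n \<in> H" "converges (restrict A l) w n [n]"
    unfolding killed_def by blast
  then show "jump A \<inter> H \<noteq> {}" using mem_jump_iff by blast
next
  assume "jump A \<inter> H \<noteq> {}"
  then obtain n w l where n: "n \<in> H" "converges (restrict A l) w n [n]"
    using mem_jump_iff by blast
  have "converges (restrict A (max l (Suc w))) w n [n]"
    using n(2) computes_restrict_mono[of A l w n "[n]" _ "max l (Suc w)"] unfolding converges_iff by auto
  then have "killed H (restrict A (max l (Suc w)))"
    using n(1) unfolding killed_def by (intro bexI[of _ w] bexI[of _ n]) auto
  then show "\<exists>l. killed H (restrict A l)" ..
qed

section \<open>Compactness of Cantor space\<close>

lemma restrict_Suc: "restrict A (Suc l) = restrict A l @ [l \<in> A]"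
  by (simp add: restrict_def)

lemma koenig:
  assumes ex: "\<And>l. \<exists>A. G (restrict A l)"
    and closed: "\<And>A l m. G (restrict A m) \<Longrightarrow> l \<le> m \<Longrightarrow> G (restrict A l)"
  shows "\<exists>A. \<forall>l. G (restrict A l)"
proof -
  \<comment> \<open>A string is kept if it has extensions satisfying \<open>G\<close> on every later
    level; the path then takes True whenever that is kept.\<close>
  define extendible where
    "extendible \<sigma> \<longleftrightarrow> (\<forall>m\<ge>length \<sigma>. \<exists>B. restrict B (length \<sigma>) = \<sigma> \<and> G (restrict B m))" for \<sigma>
  have step: "extendible (\<sigma> @ [True]) \<or> extendible (\<sigma> @ [False])" if "extendible \<sigma>" for \<sigma>
  proof (rule ccontr)
    assume "\<not> ?thesis"
    then have "\<not> extendible (\<sigma> @ [b])" for b by (cases b) auto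
    then have "\<exists>m. Suc (length \<sigma>) \<le> m \<and>
        (\<forall>B. restrict B (Suc (length \<sigma>)) = \<sigma> @ [b] \<longrightarrow> \<not> G (restrict B m))" for b
      by (auto simp: extendible_def)
    then obtain m where m: "\<And>b. Suc (length \<sigma>) \<le> m b"
      "\<And>b B. restrict B (Suc (length \<sigma>)) = \<sigma> @ [b] \<Longrightarrow> \<not> G (restrict B (m b))"
      by metis
    \<comment> \<open>If the two one-bit extensions died out at levels \<open>m True\<close> and
      \<open>m False\<close>, an extension of \<sigma> surviving at the larger level would survive,
      by downward closure, at the level where its own side is dead.\<close>
    have "length \<sigma> \<le> max (m True) (m False)" using m(1)[of True] by simp
    with that obtain B where B: "restrict B (length \<sigma>) = \<sigma>" "G (restrict B (max (m True) (m False)))"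
      unfolding extendible_def by blast
    define b where "b \<longleftrightarrow> length \<sigma> \<in> B"
    have "m b \<le> max (m True) (m False)" by (cases b) auto
    then have "G (restrict B (m b))" using closed B(2) by blast
    moreover have "restrict B (Suc (length \<sigma>)) = \<sigma> @ [b]"
      by (simp add: restrict_Suc B(1) b_def)
    ultimately show False using m(2) by blast
  qed
  define path where "path = rec_nat [] (\<lambda>_ \<sigma>. \<sigma> @ [extendible (\<sigma> @ [True])])"
  define A where "A = {n. extendible (path n @ [True])}"
  have path_Suc: "path (Suc n) = path n @ [n \<in> A]" for n
    by (simp add: path_def A_def)
  have "restrict A n = path n" for n
  proof (induction n)
    case 0
    then show ?case by (simp add: restrict_def path_def)
  next
    case (Suc n)
    then show ?case by (simp add: restrict_Suc path_Suc)
  qed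
  moreover have "extendible (path n)" for n
  proof (induction n)
    case 0
    then show ?case using ex by (simp add: extendible_def path_def restrict_def)
  next
    case (Suc n)
    then show ?case
      using step[of "path n"] by (cases "extendible (path n @ [True])") (simp_all add: path_Suc A_def)
  qed
  ultimately have "extendible (restrict A n)" for n by simp
  then have "G (restrict A n)" for n
    unfolding extendible_def by (metis length_restrict order_refl)
  then show ?thesis by blast
qed

lemma restrict_bits: "restrict {i. bit_at \<sigma> i} (length \<sigma>) = \<sigma>"
  by (rule nth_equalityI) (auto simp: restrict_def bit_at_def)

lemma compactness:
  assumes "\<And>l. \<exists>\<sigma>. length \<sigma> = l \<and> \<not> killed H \<sigma>"
  shows "\<exists>A. jump A \<inter> H = {}"
proof -
  have "\<exists>A. \<not> killed H (restrict A l)" for l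
    using assms[of l] restrict_bits by metis
  then have "\<exists>A. \<forall>l. \<not> killed H (restrict A l)"
    by (rule koenig) (use killed_restrict_mono in blast)
  then show ?thesis using killed_restrict_iff by blast
qed

definition strings :: "nat \<Rightarrow> bool list list" where
  "strings = rec_nat [[]] (\<lambda>_ ss. map (Cons True) ss @ map (Cons False) ss)"

lemma set_strings: "set (strings l) = {\<sigma>. length \<sigma> = l}"
proof (induction l)
  case (Suc l)
  have "set (strings (Suc l)) = Cons True ` set (strings l) \<union> Cons False ` set (strings l)"
    by (simp add: strings_def)
  also have "\<dots> = {\<sigma>. length \<sigma> = Suc l}"
    unfolding Suc by (auto simp: length_Suc_conv)
  finally show ?case .
qed (simp add: strings_def)

lemma recursive_strings [rec_intros]:
  assumes "recursive f" shows "recursive (\<lambda>x. strings (f x))"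
  unfolding strings_def by (intro rec_intros assms)

text \<open>Emptiness looks universal over sets. Compactness makes it existential over levels, which
  is why the halting set can answer it.\<close>

lemma all_killed_iff:
  "(\<exists>l. \<forall>\<sigma>\<in>set (strings l). killed H \<sigma>) \<longleftrightarrow> (\<forall>A. jump A \<inter> H \<noteq> {})"
proof
  assume "\<exists>l. \<forall>\<sigma>\<in>set (strings l). killed H \<sigma>"
  then obtain l where "\<forall>\<sigma>\<in>set (strings l). killed H \<sigma>" ..
  then have "killed H (restrict A l)" for A by (simp add: set_strings)
  then show "\<forall>A. jump A \<inter> H \<noteq> {}" using killed_restrict_iff by blast
next
  assume *: "\<forall>A. jump A \<inter> H \<noteq> {}"
  show "\<exists>l. \<forall>\<sigma>\<in>set (strings l). killed H \<sigma>"
  proof (rule ccontr)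
    assume "\<not> ?thesis"
    then have "\<exists>\<sigma>. length \<sigma> = l \<and> \<not> killed H \<sigma>" for l
      by (auto simp: set_strings)
    then show False using compactness * by blast
  qed
qed

text \<open>The limit real has to avoid infinitely many numbers. Emptiness would show on one finite
  level, all of whose finitely many strings are killed by a single stage of the chain.\<close>

lemma compactness_chain:
  assumes ne: "\<And>i. \<exists>A. jump A \<inter> H i = {}" and chain: "\<And>i. H i \<subseteq> H (Suc i)"
  shows "\<exists>A. jump A \<inter> (\<Union>i. H i) = {}"
proof (rule compactness, rule ccontr)
  fix l
  assume "\<not> (\<exists>\<sigma>. length \<sigma> = l \<and> \<not> killed (\<Union>i. H i) \<sigma>)"
  then have killed: "killed (\<Union>i. H i) \<sigma>" if "\<sigma> \<in> set (strings l)" for \<sigma>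
    using that by (auto simp: set_strings)
  have "\<forall>\<^sub>F i in sequentially. \<forall>\<sigma>\<in>set (strings l). killed (H i) \<sigma>"
  proof (rule eventually_ball_finite, simp, rule ballI)
    fix \<sigma> assume "\<sigma> \<in> set (strings l)"
    then obtain i where i: "killed (H i) \<sigma>" using killed unfolding killed_def by blast
    have "killed (H j) \<sigma>" if "i \<le> j" for j
      using i lift_Suc_mono_le[of H, OF chain that] unfolding killed_def by blast
    then show "\<forall>\<^sub>F i in sequentially. killed (H i) \<sigma>"
      unfolding eventually_sequentially by blast
  qed
  then obtain i where "\<forall>\<sigma>\<in>set (strings l). killed (H i) \<sigma>"
    unfolding eventually_sequentially by blast
  then have "\<forall>A. jump A \<inter> H i \<noteq> {}" using all_killed_iff by blast
  with ne show False by blast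
qed

section \<open>Indices for emptiness, single bits and splitting\<close>

lemma recursive_restrict_empty [rec_intros]:
  assumes "recursive f" shows "recursive (\<lambda>x. restrict {} (f x))"
proof -
  have "restrict {} n = map (\<lambda>_. False) [0..<n]" for n by (simp add: restrict_def)
  then show ?thesis by (simp only:) (intro rec_intros assms)
qed

text \<open>The search for a level of killed strings consults no oracle bit, so its index works for
  the jump of any set, here the empty one.\<close>

lemma emptiness_index:
  obtains emp :: "nat list \<Rightarrow> nat" where "recursive emp"
    "\<And>h. emp h \<in> halting \<longleftrightarrow> (\<forall>A. jump A \<inter> set h \<noteq> {})"
proof -
  have "recursive (\<lambda>z :: nat list \<times> nat \<times> bool.
      \<forall>\<sigma>\<in>set (strings (fst (snd z))). killed (set (fst z)) \<sigma>)"
    by (intro rec_intros)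
  from jump_search[of "\<lambda>_ _. 0" "\<lambda>h l _. \<forall>\<sigma>\<in>set (strings l). killed (set h) \<sigma>",
      OF recursive_const this]
  obtain g :: "nat list \<Rightarrow> nat" where g: "recursive g"
    "\<And>h A. g h \<in> jump A \<longleftrightarrow> (\<exists>l. \<forall>\<sigma>\<in>set (strings l). killed (set h) \<sigma>)" by blast
  show thesis
    by (rule that[OF g(1)]) (simp only: halting_def g(2) all_killed_iff)
qed

text \<open>Turns a requirement on one bit into a forbidden number, so that coding stays within the
  classes given by lists.\<close>

lemma bit_index:
  obtains j :: "nat \<times> bool \<Rightarrow> nat" where "recursive j"
    "\<And>n b A. j (n, b) \<in> jump A \<longleftrightarrow> (n \<in> A) \<noteq> b"
proof -
  have "recursive (\<lambda>z :: (nat \<times> bool) \<times> nat. fst (fst z))"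
    "recursive (\<lambda>z :: (nat \<times> bool) \<times> nat \<times> bool. \<not> (snd (snd z) = snd (fst z)))"
    by (intro rec_intros)+
  from jump_search[of "\<lambda>a _. fst a" "\<lambda>a _ b. \<not> (b = snd a)", OF this]
  obtain j :: "nat \<times> bool \<Rightarrow> nat" where "recursive j"
    "\<And>a A. j a \<in> jump A \<longleftrightarrow> (\<exists>s :: nat. \<not> ((fst a \<in> A) = snd a))" by blast
  then show thesis by (intro that[of j]) auto
qed

lemma computes_restrict_imp_eval:
  assumes "computes (restrict A l) w (encode p) xs v"
  shows "eval (set_oracle A) p xs v"
proof -
  obtain p' where "encode p' = encode p" "eval (str_oracle (restrict A l)) p' xs v"
    using assms by (rule computes_sound)
  then show ?thesis using encode_injective[of p' p] eval_restrict_imp_eval by simp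
qed

lemma eval_imp_computes_restrict:
  assumes "eval (set_oracle A) p xs v"
  shows "\<exists>w l. computes (restrict A l) w (encode p) xs v"
proof -
  obtain l where "eval (str_oracle (restrict A l)) p xs v"
    using eval_imp_eventually_eval_restrict[OF assms] unfolding eventually_sequentially by blast
  then show ?thesis using computes_complete by blast
qed

text \<open>The sets whose jump omits \<open>d\<close> form an analogue of the class of diagonally nonrecursive
  functions: membership of \<open>encode p\<close> is dictated by the parity of the value that \<open>p\<close> takes on its own
  code, if any.\<close>

lemma parity_index:
  obtains d :: nat where
    "\<And>A. d \<in> jump A \<longleftrightarrow> (\<exists>p v. eval (set_oracle {}) p [encode p] v \<and> (encode p \<in> A) \<noteq> odd v)"
proof -
  \<comment> \<open>The search variable \<open>s\<close> packs a program code, a value, a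
    certificate and the length of the prefix of the empty oracle.\<close>
  let ?e = "\<lambda>s. fst (ungn s :: nat \<times> nat \<times> nat \<times> nat)"
  let ?v = "\<lambda>s. fst (snd (ungn s :: nat \<times> nat \<times> nat \<times> nat))"
  let ?w = "\<lambda>s. fst (snd (snd (ungn s :: nat \<times> nat \<times> nat \<times> nat)))"
  let ?l = "\<lambda>s. snd (snd (snd (ungn s :: nat \<times> nat \<times> nat \<times> nat)))"
  let ?test = "\<lambda>s b. computes (restrict {} (?l s)) (?w s) (?e s) [?e s] (?v s) \<and> \<not> (b = odd (?v s))"
  have "recursive (\<lambda>z :: nat \<times> nat. ?e (snd z))"
    "recursive (\<lambda>z :: nat \<times> nat \<times> bool. ?test (fst (snd z)) (snd (snd z)))"
    by (intro rec_intros)+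
  from this obtain g :: "nat \<Rightarrow> nat" where "recursive g"
    and g: "\<And>a A. g a \<in> jump A \<longleftrightarrow> (\<exists>s. ?test s (?e s \<in> A))"
    by (rule jump_search) (rule that)
  have "(\<exists>s. ?test s (?e s \<in> A)) \<longleftrightarrow>
      (\<exists>p v. eval (set_oracle {}) p [encode p] v \<and> (encode p \<in> A) \<noteq> odd v)" for A
  proof
    assume "\<exists>s. ?test s (?e s \<in> A)"
    then obtain s where s: "?test s (?e s \<in> A)" ..
    then obtain p where p: "encode p = ?e s" by (metis computes_sound)
    with s have "eval (set_oracle {}) p [encode p] (?v s)"
      using computes_restrict_imp_eval[of "{}" "?l s" "?w s" p] by simp
    with s p show "\<exists>p v. eval (set_oracle {}) p [encode p] v \<and> (encode p \<in> A) \<noteq> odd v" by metis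
  next
    assume "\<exists>p v. eval (set_oracle {}) p [encode p] v \<and> (encode p \<in> A) \<noteq> odd v"
    then obtain p v w l where "computes (restrict {} l) w (encode p) [encode p] v" "(encode p \<in> A) \<noteq> odd v"
      using eval_imp_computes_restrict by blast
    then have "?test (gn (encode p, v, w, l)) (?e (gn (encode p, v, w, l)) \<in> A)"
      unfolding ungn_gn by simp
    then show "\<exists>s. ?test s (?e s \<in> A)" by blast
  qed
  then show thesis by (intro that[of "g 0"]) (simp only: g)
qed

text \<open>The set of codes whose diagonal value is odd obeys the dictate; determinism and
  injectivity of \<open>encode\<close> exclude conflicting demands.\<close>

lemma parity_class_nonempty:
  assumes "\<And>A. d \<in> jump A \<longleftrightarrow> (\<exists>p v. eval (set_oracle {}) p [encode p] v \<and> (encode p \<in> A) \<noteq> odd v)"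
  shows "\<exists>A. d \<notin> jump A"
proof -
  let ?A = "{encode p | p v. eval (set_oracle {}) p [encode p] v \<and> odd v}"
  have "encode p \<in> ?A \<longleftrightarrow> odd v" if v: "eval (set_oracle {}) p [encode p] v" for p v
  proof
    assume "encode p \<in> ?A"
    then obtain p' v' where "encode p = encode p'" and v': "eval (set_oracle {}) p' [encode p'] v'" "odd v'"
      by blast
    then have "p' = p" using encode_injective[of p' p] by simp
    with v' v eval_deterministic show "odd v" by blast
  qed (use v in blast)
  then have "d \<notin> jump ?A" unfolding assms by blast
  then show ?thesis ..
qed

text \<open>Effective incompleteness: the program with code \<open>split h\<close>, run on its own code \<open>n\<close>, searches for
  a proof that one of the two ways of deciding \<open>n\<close> leaves the class of \<open>h\<close> empty, and on success
  returns a value whose parity forces all members of the parity class to decide \<open>n\<close> in that way.\<close>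

lemma splitting_index:
  assumes d: "\<And>A. d \<in> jump A \<longleftrightarrow> (\<exists>p v. eval (set_oracle {}) p [encode p] v \<and> (encode p \<in> A) \<noteq> odd v)"
    and rec_j: "recursive j" and j: "\<And>n b A. j (n, b) \<in> jump A \<longleftrightarrow> (n \<in> A) \<noteq> b"
  obtains split :: "nat list \<Rightarrow> nat" where "recursive split"
    "\<And>h A b. d \<in> set h \<Longrightarrow> jump A \<inter> set h = {} \<Longrightarrow> \<exists>B. jump B \<inter> set (j (split h, b) # h) = {}"
proof -
  \<comment> \<open>A candidate \<open>v\<close> carries two data: the level \<open>v div 2\<close>
    on which all strings must be killed, and the bit \<open>odd v\<close> of the side claimed to be
    empty.\<close>
  let ?test = "\<lambda>h x v. \<forall>\<sigma>\<in>set (strings (v div 2)). killed (set (j (x, odd v) # h)) \<sigma>"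
  have "recursive (\<lambda>z :: nat list \<times> nat \<times> nat \<times> bool. ?test (fst z) (fst (snd z)) (fst (snd (snd z))))"
    by (intro rec_intros recursive_compose[OF rec_j])
  from search_program[of "\<lambda>_ _ _. 0" "\<lambda>h x v _. ?test h x v", OF recursive_const this]
  obtain g :: "nat list \<Rightarrow> nat" where g: "recursive g" "\<And>h. \<exists>p. encode p = g h \<and>
      (\<forall>A x v. eval (set_oracle A) p [x] v \<longleftrightarrow> ?test h x v \<and> (\<forall>u<v. \<not> ?test h x u))"
    by blast
  have "\<exists>B. jump B \<inter> set (j (g h, b) # h) = {}"
    if h: "d \<in> set h" "jump A \<inter> set h = {}" for h A b
  proof (rule ccontr)
    assume "\<not> ?thesis"
    then have "\<forall>B. jump B \<inter> set (j (g h, b) # h) \<noteq> {}" by blast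
    then obtain l where "\<forall>\<sigma>\<in>set (strings l). killed (set (j (g h, b) # h)) \<sigma>"
      unfolding all_killed_iff[symmetric] by blast
    \<comment> \<open>Emptiness of side \<open>b\<close> makes the search succeed. Its first success
      may concern the other side, so the argument continues with \<open>odd v\<close> in place of
      \<open>b\<close>.\<close>
    then have "?test h (g h) (2 * l + of_bool b)" by (cases b) simp_all
    then obtain v where v: "?test h (g h) v" "\<forall>u<v. \<not> ?test h (g h) u"
      using exists_least_iff[of "?test h (g h)"] by blast
    obtain p where p: "encode p = g h"
      "\<forall>A x v. eval (set_oracle A) p [x] v \<longleftrightarrow> ?test h x v \<and> (\<forall>u<v. \<not> ?test h x u)"
      using g(2)[of h] by (elim exE conjE)
    have "eval (set_oracle {}) p [encode p] v" using p v by simp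
    moreover have "d \<notin> jump A" using h by blast
    \<comment> \<open>Being in the parity class, the given member \<open>A\<close> takes side
      \<open>odd v\<close>, the very side just certified to be empty.\<close>
    ultimately have "g h \<in> A \<longleftrightarrow> odd v" using d p(1) by metis
    then have "j (g h, odd v) \<notin> jump A" by (simp add: j)
    with h(2) have "jump A \<inter> set (j (g h, odd v) # h) = {}" by simp
    moreover have "jump A \<inter> set (j (g h, odd v) # h) \<noteq> {}"
      using v(1) all_killed_iff[of "set (j (g h, odd v) # h)"] by blast
    ultimately show False by blast
  qed
  with g(1) that show thesis by blast
qed

lemma table_le_jump: "table_le A (jump A)"
proof -
  have "recursive (\<lambda>z :: nat \<times> nat. fst z)" "recursive (\<lambda>z :: nat \<times> nat \<times> bool. snd (snd z))"
    by (intro rec_intros)+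
  from jump_search[of "\<lambda>n _. n" "\<lambda>_ _ b. b", OF this]
  obtain g :: "nat \<Rightarrow> nat" where g: "recursive g" "\<And>n A. g n \<in> jump A \<longleftrightarrow> n \<in> A" by auto
  from table_le_vimage[OF g(1), of "jump A"] show ?thesis by (simp add: g(2))
qed

text \<open>A program with any oracle can search for a certificate over prefixes of the empty
  set.\<close>

lemma table_le_halting_jump: "table_le halting (jump A)"
proof -
  let ?w = "\<lambda>s. fst (ungn s :: nat \<times> nat)" and ?l = "\<lambda>s. snd (ungn s :: nat \<times> nat)"
  have "recursive (\<lambda>z :: nat \<times> nat \<times> bool.
      converges (restrict {} (?l (fst (snd z)))) (?w (fst (snd z))) (fst z) [fst z])"
    by (intro rec_intros)
  from jump_search[of "\<lambda>_ _. 0" "\<lambda>n s _. converges (restrict {} (?l s)) (?w s) n [n]", OF recursive_const this]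
  obtain g :: "nat \<Rightarrow> nat" where g: "recursive g"
    "\<And>n A. g n \<in> jump A \<longleftrightarrow> (\<exists>s. converges (restrict {} (?l s)) (?w s) n [n])" by blast
  have "(\<exists>s. P (ungn s)) \<longleftrightarrow> (\<exists>z. P z)" for P :: "nat \<times> nat \<Rightarrow> bool"
    using ungn_gn by metis
  from this[of "\<lambda>z. converges (restrict {} (snd z)) (fst z) n [n]" for n]
  have "g n \<in> jump A \<longleftrightarrow> n \<in> halting" for n
    by (simp add: g(2) halting_def mem_jump_iff[of _ "{}"])
  then show ?thesis using table_le_vimage[OF g(1), of "jump A"] by simp
qed

section \<open>Jump inversion\<close>

text \<open>Both reductions retrace the same states \<open>h\<close>. They differ only in where an
  odd step finds its bit: in \<open>X\<close> directly, or in \<open>Y\<close> at the position given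
  by \<open>split\<close>. Even steps query the halting set in both cases.\<close>

lemma truth_table_jump_inversion:
  obtains Y where "table_le (join (jump Y) X) (join X halting)"
    "table_le (join (jump Y) X) (join Y halting)"
proof -
  obtain emp :: "nat list \<Rightarrow> nat" where rec_emp: "recursive emp"
    and emp: "\<And>h. emp h \<in> halting \<longleftrightarrow> (\<forall>A. jump A \<inter> set h \<noteq> {})"
    using emptiness_index by blast
  obtain j :: "nat \<times> bool \<Rightarrow> nat" where rec_j: "recursive j"
    and j: "\<And>n b A. j (n, b) \<in> jump A \<longleftrightarrow> (n \<in> A) \<noteq> b"
    using bit_index by blast
  obtain d where d: "\<And>A. d \<in> jump A \<longleftrightarrow>
      (\<exists>p v. eval (set_oracle {}) p [encode p] v \<and> (encode p \<in> A) \<noteq> odd v)"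
    using parity_index by blast
  obtain split :: "nat list \<Rightarrow> nat" where rec_split: "recursive split"
    and split: "\<And>h A b. d \<in> set h \<Longrightarrow> jump A \<inter> set h = {} \<Longrightarrow>
      \<exists>B. jump B \<inter> set (j (split h, b) # h) = {}"
    using splitting_index[OF d rec_j j] by blast
  \<comment> \<open>Step \<open>2 e\<close> decides whether \<open>e\<close> enters the jump, step \<open>2 e + 1\<close> codes \<open>X(e)\<close>.\<close>
  define upd where "upd i h b =
    (if odd i then j (split h, b) # h else if b then h else i div 2 # h)" for i :: nat and h b
  define answer where "answer i h \<longleftrightarrow>
    (if odd i then i div 2 \<in> X else emp (i div 2 # h) \<in> halting)" for i :: nat and h
  define h where "h = rec_nat [d] (\<lambda>i h. upd i h (answer i h))"
  have h_Suc: "h (Suc i) = upd i (h i) (answer i (h i))" for i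
    by (simp add: h_def)
  have chain: "set (h i) \<subseteq> set (h (Suc i))" for i
    by (auto simp: h_Suc upd_def)
  have d_in: "d \<in> set (h i)" for i
  proof (induction i)
    case (Suc i)
    then show ?case using chain by blast
  qed (simp add: h_def)
  have nonempty: "\<exists>A. jump A \<inter> set (h i) = {}" for i
  proof (induction i)
    case 0
    show ?case using parity_class_nonempty[OF d] by (simp add: h_def)
  next
    case (Suc i)
    then obtain A where A: "jump A \<inter> set (h i) = {}" ..
    show ?case
    proof (cases "odd i")
      case True
      then show ?thesis using split[OF d_in A] by (simp add: h_Suc upd_def)
    next
      case False
      then show ?thesis using A emp[of "i div 2 # h i"] by (auto simp: h_Suc upd_def answer_def)
    qed
  qed
  \<comment> \<open>Any member of the limit class will do: its jump and its coded bits are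
    determined by the states alone.\<close>
  obtain Y where "jump Y \<inter> (\<Union>i. set (h i)) = {}"
    using compactness_chain[of "\<lambda>i. set (h i)", OF nonempty chain] ..
  then have Y: "jump Y \<inter> set (h i) = {}" for i by blast
  have coded: "split (h i) \<in> Y \<longleftrightarrow> i div 2 \<in> X" if "odd i" for i
  proof -
    have "j (split (h i), i div 2 \<in> X) \<notin> jump Y"
      using Y[of "Suc i"] that by (simp add: h_Suc upd_def answer_def)
    then show ?thesis by (simp add: j)
  qed
  \<comment> \<open>If forbidding \<open>i div 2\<close> empties the class, every member has it in
    its jump; otherwise it was forbidden at this very step.\<close>
  have forced: "i div 2 \<in> jump Y \<longleftrightarrow> emp (i div 2 # h i) \<in> halting" if "even i" for i
  proof
    assume "i div 2 \<in> jump Y"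
    show "emp (i div 2 # h i) \<in> halting"
    proof (rule ccontr)
      assume "emp (i div 2 # h i) \<notin> halting"
      then have "i div 2 \<in> set (h (Suc i))" using that by (simp add: h_Suc upd_def answer_def)
      with Y \<open>i div 2 \<in> jump Y\<close> show False by blast
    qed
  next
    assume "emp (i div 2 # h i) \<in> halting"
    then have "jump Y \<inter> set (i div 2 # h i) \<noteq> {}" using emp by blast
    with Y[of i] show "i div 2 \<in> jump Y" by auto
  qed
  \<comment> \<open>The internal answers turn out to be the bits of \<open>join (jump Y) X\<close>,
    as the adaptive reduction requires.\<close>
  have step: "h (Suc i) = upd i (h i) (i \<in> join (jump Y) X)" for i
    by (simp add: h_Suc answer_def mem_join forced)
  have rec_upd: "recursive (\<lambda>z. upd (fst z) (fst (snd z)) (snd (snd z)))"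
    unfolding upd_def by (intro rec_intros recursive_compose[OF rec_j] recursive_compose[OF rec_split])
  have "table_le (join (jump Y) X) (join X halting)"
  proof (rule table_le_adaptive[where h = h, OF _ rec_upd step])
    \<comment> \<open>A join keeps its first set at even positions and its second at odd ones, so
      bit \<open>i div 2\<close> of \<open>X\<close> sits at \<open>2 * (i div 2)\<close>.\<close>
    let ?q = "\<lambda>i h. if odd i then 2 * (i div 2) else Suc (2 * emp (i div 2 # h))"
    show "recursive (\<lambda>z. ?q (fst z) (snd z))"
      by (intro rec_intros recursive_compose[OF rec_emp])
    show "i \<in> join (jump Y) X \<longleftrightarrow> ?q i (h i) \<in> join X halting" for i
      by (cases "odd i") (auto simp: mem_join forced elim: oddE)
  qed
  moreover have "table_le (join (jump Y) X) (join Y halting)"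
  proof (rule table_le_adaptive[where h = h, OF _ rec_upd step])
    let ?q = "\<lambda>i h. if odd i then 2 * split h else Suc (2 * emp (i div 2 # h))"
    show "recursive (\<lambda>z. ?q (fst z) (snd z))"
      by (intro rec_intros recursive_compose[OF rec_emp] recursive_compose[OF rec_split])
    show "i \<in> join (jump Y) X \<longleftrightarrow> ?q i (h i) \<in> join Y halting" for i
      by (simp add: mem_join forced coded)
  qed
  ultimately show thesis using that by blast
qed

theorem mainTheorem2:
  fixes X :: "nat set"
  assumes "tt_le halting X"
  shows "\<exists>Y :: nat set. tt_eq (join Y halting) (jump Y) \<and> tt_eq (jump Y) X"
proof -
  obtain Y where run_X: "table_le (join (jump Y) X) (join X halting)"
    and run_Y: "table_le (join (jump Y) X) (join Y halting)"
    using truth_table_jump_inversion by blast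
  have 1: "table_le (join Y halting) (jump Y)"
    by (rule table_le_join[OF table_le_jump table_le_halting_jump])
  have 2: "table_le (jump Y) (join Y halting)"
    by (rule table_le_trans[OF table_le_join_left run_Y])
  \<comment> \<open>Here the hypothesis enters: an \<open>X\<close> above the halting set can
    replace \<open>join X halting\<close> as oracle.\<close>
  have "table_le (join X halting) X"
    using assms table_le_join[OF table_le_refl] unfolding tt_le_iff_table_le by blast
  then have 3: "table_le (jump Y) X"
    using table_le_trans[OF table_le_join_left table_le_trans[OF run_X]] by blast
  have 4: "table_le X (jump Y)"
    using table_le_trans[OF table_le_trans[OF table_le_join_right run_Y] 1] .
  show ?thesis
    unfolding tt_eq_def tt_le_iff_table_le using 1 2 3 4 by blast
qed

end
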